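(* The decision problems $\mathrm{NonPrim}$ and $\mathrm{EqSatCF}$ are polynomially equivalent, that is, $\mathrm{NonPrim}\leq_p \mathrm{EqSatCF}$ and $\mathrm{EqSatCF}\leq_p\mathrm{NonPrim}$.
   Context: Alphabets are finite and have at least two letters. Fix a target alphabet $\Gamma$ (the answers to the problems below do not depend on its choice). A morphism $h:\Sigma^*\to\Gamma^*$ is a map with $h(xy)=h(x)h(y)$ for all words $x,y$; it is periodic if there is a word $r$ with $h(x)\in r^*$ for all letters $x\in\Sigma$, and nonperiodic otherwise. A constant-free word equation over an alphabet $\Sigma$ (of variables) is a pair $(u,v)\in\Sigma^*\times\Sigma^*$; a solution of it is a morphism $h:\Sigma^*\to\Gamma^*$ with $h(u)=h(v)$. A system of equations is a set of equations, and a solution of a system is a morphism that is a solution of every equation in it. Decision problems: - $\mathrm{EqSatCF}$: given an alphabet $\Sigma$ and a finite system of constant-free word equations over $\Sigma$, decide whether the system has a nonperiodic solution. - $\mathrm{NonPrim}$: given an alphabet $\Sigma$ and a word $w\in\Sigma^+$, decide whether there exist an integer $n\geq 2$, a nonperiodic morphism $h:\Sigma^*\to\Gamma^*$ and a nonempty word $r\in\Gamma^+$ with $h(w)=r^n$. $A\leq_p B$ means that $A$ is polynomial-time (many-one) reducible to $B$. *)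

theory Defs
  imports "HOL-Computational_Algebra.Polynomial"
begin

section \<open>Polynomial-time many-one reductions\<close>

subsection \<open>Deterministic multi-tape Turing machines\<close>

text \<open>
  A tape \<open>(l, r)\<close> is infinite in both directions. The list \<open>r\<close> holds the scanned cell and the
  cells to its right, \<open>l\<close> the cells to the left of the head, nearest first; all cells beyond the
  two lists are blank.
\<close>

type_synonym tape = "nat list \<times> nat list"

datatype dir = Go_Left | Stay | Go_Right

abbreviation blank :: nat where
  "blank \<equiv> 0"

definition scanned :: "tape \<Rightarrow> nat" where
  "scanned t = (case snd t of [] \<Rightarrow> blank | a # _ \<Rightarrow> a)"

fun act :: "nat \<times> dir \<Rightarrow> tape \<Rightarrow> tape" where
  "act (s, Stay) (l, r) = (l, s # tl r)"
| "act (s, Go_Right) (l, r) = (s # l, tl r)"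
| "act (s, Go_Left) ([], r) = ([], blank # s # tl r)"
| "act (s, Go_Left) (a # l, r) = (l, a # s # tl r)"

record tm =
  num_tapes :: nat
  states :: "nat set"
  symbols :: "nat set"
  start :: nat
  final :: "nat set"
  delta :: "nat \<Rightarrow> nat list \<Rightarrow> nat \<times> (nat \<times> dir) list"

text \<open>
  On inputs over \<open>symbols\<close>, the function \<open>delta\<close> is applied only to the finitely many pairs of a
  non-final state and a tuple of \<open>num_tapes\<close> scanned symbols, so it amounts to a finite table.
\<close>

definition turing_machine :: "tm \<Rightarrow> bool" where
  "turing_machine M \<longleftrightarrow>
     num_tapes M \<ge> 1 \<and> finite (states M) \<and> finite (symbols M) \<and> blank \<in> symbols M \<and>
     start M \<in> states M \<and> final M \<subseteq> states M \<and>
     (\<forall>q \<in> states M - final M. \<forall>ss \<in> lists (symbols M). length ss = num_tapes M \<longrightarrow>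
        fst (delta M q ss) \<in> states M \<and>
        length (snd (delta M q ss)) = num_tapes M \<and>
        (\<forall>(s, d) \<in> set (snd (delta M q ss)). s \<in> symbols M))"

type_synonym config = "nat \<times> tape list"

definition step :: "tm \<Rightarrow> config \<Rightarrow> config" where
  "step M c =
     (let (q, ts) = c in
      if q \<in> final M then c
      else let (q', as) = delta M q (map scanned ts) in (q', map2 act as ts))"

definition initial_config :: "tm \<Rightarrow> nat list \<Rightarrow> config" where
  "initial_config M x = (start M, ([], x) # replicate (num_tapes M - 1) ([], []))"

text \<open>
  The output is read on the last tape, from the head to the right up to the first blank. A
  one-tape machine has its input and its output on the same tape.
\<close>

definition tape_output :: "config \<Rightarrow> nat list" where
  "tape_output c = takeWhile (\<lambda>s. s \<noteq> blank) (snd (last (snd c)))"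

text \<open>
  Since \<open>step\<close> leaves final configurations unchanged, \<open>t\<close> is an upper bound on the running time.
\<close>

definition outputs_within :: "tm \<Rightarrow> nat \<Rightarrow> nat list \<Rightarrow> nat list \<Rightarrow> bool" where
  "outputs_within M t x y \<longleftrightarrow>
     (let c = (step M ^^ t) (initial_config M x) in fst c \<in> final M \<and> tape_output c = y)"

subsection \<open>Decision problems and reductions\<close>

text \<open>
  A decision problem is a set of instances, a question about them, and an encoding of instances
  as strings. A reduction maps instances to instances (as in Garey and Johnson); it need not be
  specified on strings that encode no instance.
\<close>

record 'i decision_problem =
  instances :: "'i set"
  answer_yes :: "'i \<Rightarrow> bool"
  encode :: "'i \<Rightarrow> nat list"

definition polytime_computable ::
  "'i decision_problem \<Rightarrow> 'j decision_problem \<Rightarrow> ('i \<Rightarrow> 'j) \<Rightarrow> bool" where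
  "polytime_computable A B f \<longleftrightarrow>
     (\<exists>(M :: tm) (p :: nat poly). turing_machine M \<and>
        (\<forall>I \<in> instances A.
           encode A I \<in> lists (symbols M - {blank}) \<and>
           outputs_within M (poly p (length (encode A I))) (encode A I) (encode B (f I))))"

definition poly_reducible ::
  "'i decision_problem \<Rightarrow> 'j decision_problem \<Rightarrow> bool"  (infix \<open>\<le>\<^sub>p\<close> 50) where
  "A \<le>\<^sub>p B \<longleftrightarrow>
     (\<exists>f. polytime_computable A B f \<and>
        (\<forall>I \<in> instances A.
           f I \<in> instances B \<and> (answer_yes A I \<longleftrightarrow> answer_yes B (f I))))"


section \<open>Morphisms and word equations\<close>

text \<open>
  A morphism is a function on words. Only its values on words over the source alphabet matter.
\<close>

definition morphism :: "'a set \<Rightarrow> 'b set \<Rightarrow> ('a list \<Rightarrow> 'b list) \<Rightarrow> bool" where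
  "morphism \<Sigma> \<Gamma> h \<longleftrightarrow>
     (\<forall>x \<in> lists \<Sigma>. h x \<in> lists \<Gamma>) \<and>
     (\<forall>x \<in> lists \<Sigma>. \<forall>y \<in> lists \<Sigma>. h (x @ y) = h x @ h y)"

definition word_power :: "'a list \<Rightarrow> nat \<Rightarrow> 'a list" where
  "word_power r n = concat (replicate n r)"

definition periodic :: "'a set \<Rightarrow> 'b set \<Rightarrow> ('a list \<Rightarrow> 'b list) \<Rightarrow> bool" where
  "periodic \<Sigma> \<Gamma> h \<longleftrightarrow> (\<exists>r \<in> lists \<Gamma>. \<forall>a \<in> \<Sigma>. \<exists>k. h [a] = word_power r k)"

definition nonperiodic_morphism :: "'a set \<Rightarrow> 'b set \<Rightarrow> ('a list \<Rightarrow> 'b list) \<Rightarrow> bool" where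
  "nonperiodic_morphism \<Sigma> \<Gamma> h \<longleftrightarrow> morphism \<Sigma> \<Gamma> h \<and> \<not> periodic \<Sigma> \<Gamma> h"

type_synonym 'a equation = "'a list \<times> 'a list"

definition solves :: "('a list \<Rightarrow> 'b list) \<Rightarrow> 'a equation set \<Rightarrow> bool" where
  "solves h E \<longleftrightarrow> (\<forall>(u, v) \<in> E. h u = h v)"


section \<open>The two problems\<close>

text \<open>
  The alphabet of an instance is \<open>{..<n}\<close>, and a finite system is presented as a list of its
  equations. In strings, the number \<open>k\<close> is written as \<open>1\<^sup>k 2\<close>. Since \<open>n\<close> is the size of an
  alphabet that is itself part of the instance, writing \<open>n\<close> and the letters in unary changes the
  input length only polynomially compared to listing the letters with binary names.
\<close>

definition encode_nat :: "nat \<Rightarrow> nat list" where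
  "encode_nat k = replicate k 1 @ [2]"

definition encode_word :: "nat list \<Rightarrow> nat list" where
  "encode_word w = concat (map encode_nat w)"

definition encode_equation :: "nat equation \<Rightarrow> nat list" where
  "encode_equation e = encode_word (fst e) @ [3] @ encode_word (snd e) @ [4]"

definition NonPrim :: "'g set \<Rightarrow> (nat \<times> nat list) decision_problem" where
  "NonPrim \<Gamma> =
     \<lparr> instances = {(n, w). n \<ge> 2 \<and> w \<in> lists {..<n} \<and> w \<noteq> []},
       answer_yes = (\<lambda>(n, w). \<exists>m h r. m \<ge> 2 \<and> nonperiodic_morphism {..<n} \<Gamma> h \<and>
         r \<in> lists \<Gamma> \<and> r \<noteq> [] \<and> h w = word_power r m),
       encode = (\<lambda>(n, w). encode_nat n @ encode_word w) \<rparr>"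

definition EqSatCF :: "'g set \<Rightarrow> (nat \<times> nat equation list) decision_problem" where
  "EqSatCF \<Gamma> =
     \<lparr> instances = {(n, E). n \<ge> 2 \<and> set E \<subseteq> lists {..<n} \<times> lists {..<n}},
       answer_yes = (\<lambda>(n, E). \<exists>h. nonperiodic_morphism {..<n} \<Gamma> h \<and> solves h (set E)),
       encode = (\<lambda>(n, E). encode_nat n @ concat (map encode_equation E)) \<rparr>"

end

theory Submission
  imports Defs
begin

text \<open>
  Since an integer is at least 2 iff it is \<open>3i + 2j \<noteq> 0\<close>, a word \<open>h w\<close> is a proper power iff
  it is \<open>s\<^sup>3 t\<^sup>2\<close> for commuting words \<open>s\<close> and \<open>t\<close>; this reduces \<open>NonPrim\<close> to the system
  \<open>w = s\<^sup>3 t\<^sup>2\<close>, \<open>s t = t s\<close>. If \<open>w\<close> does not contain all variables, both answers are positive.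

  Conversely, let \<open>z\<close> be the product of all variables and all sides of the equations
  \<open>u\<^sub>i = v\<^sub>i\<close>, and let \<open>g = z z (x\<^sub>1 z) (x\<^sub>2 z) \<dots>\<close>, where \<open>x\<^sub>1 x\<^sub>2 \<dots> = z\<close>. If \<open>h g\<close> overlaps
  itself with a nonempty shift of length at most \<open>|h z|\<close>, then all variables commute with the shift,
  so \<open>h\<close> is periodic. Put \<open>a = g u\<^sub>1 g u\<^sub>2 g \<dots>\<close> and \<open>b = g v\<^sub>1 g v\<^sub>2 g \<dots>\<close>. If
  \<open>h (a\<^sup>4 b)\<close> is a proper power, then \<open>h a\<close> and \<open>h b\<close> commute; since their lengths differ by at most
  \<open>|h z|\<close>, they are equal for nonperiodic \<open>h\<close>, and the markers \<open>h g\<close> are then aligned, so that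
  \<open>h u\<^sub>i = h v\<^sub>i\<close> for all \<open>i\<close>.
\<close>

section \<open>Structured programs for Turing machines\<close>

definition cells :: "nat list \<Rightarrow> nat \<Rightarrow> nat" where
  "cells xs i = (if i < length xs then xs ! i else blank)"

text \<open>Machine steps can leave explicit blanks at the far end of either list, so one tape has
  many list representations. Runs are compared only up to this relation.\<close>

definition same_tape :: "tape \<Rightarrow> tape \<Rightarrow> bool" (infix \<open>\<sim>\<close> 50) where
  "t \<sim> t' \<longleftrightarrow> cells (fst t) = cells (fst t') \<and> cells (snd t) = cells (snd t')"

lemma cells_Nil [simp]: "cells [] = (\<lambda>_. blank)"
  by (simp add: cells_def fun_eq_iff)

lemma cells_Cons: "cells (x # xs) = case_nat x (cells xs)"
  by (auto simp: cells_def fun_eq_iff split: nat.split)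

lemma cells_tl: "cells (tl xs) = (\<lambda>i. cells xs (Suc i))"
  by (cases xs) (auto simp: cells_def fun_eq_iff)

lemma scanned_cells: "scanned t = cells (snd t) 0"
  by (auto simp: scanned_def cells_def split: list.split)

lemma act_cells:
  "cells (fst (act (s, d) t)) = (case d of Stay \<Rightarrow> cells (fst t)
      | Go_Right \<Rightarrow> case_nat s (cells (fst t)) | Go_Left \<Rightarrow> (\<lambda>i. cells (fst t) (Suc i)))"
  "cells (snd (act (s, d) t)) = (case d of Stay \<Rightarrow> case_nat s (\<lambda>i. cells (snd t) (Suc i))
      | Go_Right \<Rightarrow> (\<lambda>i. cells (snd t) (Suc i))
      | Go_Left \<Rightarrow> case_nat (cells (fst t) 0) (case_nat s (\<lambda>i. cells (snd t) (Suc i))))"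
  by (cases "((s, d), t)" rule: act.cases;
      auto simp: cells_Cons cells_tl fun_eq_iff split: nat.split)+

lemma same_tape_refl [simp]: "t \<sim> t"
  by (simp add: same_tape_def)

lemma same_tape_trans [trans]: "t \<sim> t' \<Longrightarrow> t' \<sim> t'' \<Longrightarrow> t \<sim> t''"
  by (simp add: same_tape_def)

lemma same_tape_scanned: "t \<sim> t' \<Longrightarrow> scanned t = scanned t'"
  by (simp add: same_tape_def scanned_cells)

lemma same_tape_act: "t \<sim> t' \<Longrightarrow> act x t \<sim> act x t'"
  by (cases x) (simp add: same_tape_def act_cells split: dir.split)

text \<open>On an empty right list the scanned blank gets written explicitly, so only
  \<open>\<sim>\<close> holds and not equality.\<close>

lemma same_tape_stay: "t \<sim> t' \<Longrightarrow> act (scanned t, Stay) t \<sim> t'"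
  by (auto simp: same_tape_def act_cells scanned_cells fun_eq_iff split: nat.split)

text \<open>Makes the output of a tape independent of its representation.\<close>

lemma takeWhile_cells:
  "cells xs = cells ys \<Longrightarrow> takeWhile (\<lambda>s. s \<noteq> blank) xs = takeWhile (\<lambda>s. s \<noteq> blank) ys"
proof (induction xs arbitrary: ys)
  case Nil
  then have "cells ys 0 = blank"
    by (metis cells_Nil)
  then show ?case
    by (cases ys) (auto simp: cells_def)
next
  case (Cons x xs)
  have hd: "cells ys 0 = x" and tl: "cells (tl ys) = cells xs"
    using Cons.prems [symmetric] by (simp_all add: cells_tl cells_Cons)
  show ?case
  proof (cases ys)
    case Nil
    with hd show ?thesis
      by simp
  next
    case (Cons y ys')
    with hd tl Cons.IH [of ys'] show ?thesis
      by (simp add: cells_Cons)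
  qed
qed

section \<open>While programs and their compilation to transition tables\<close>

datatype prog =
    Act nat "nat list \<Rightarrow> nat" dir
  | Seq prog prog  (infixr \<open>;;\<close> 60)
  | While nat "nat set" prog

text \<open>The two extra states of a loop are the test at its entry and the jump back behind its
  body.\<close>

fun psize :: "prog \<Rightarrow> nat" where
  "psize (Act i g d) = 1"
| "psize (p ;; q) = psize p + psize q"
| "psize (While i S p) = psize p + 2"

definition stay :: "nat list \<Rightarrow> (nat \<times> dir) list" where
  "stay ss = map (\<lambda>s. (s, Stay)) ss"

text \<open>The code of \<open>p\<close> placed at address \<open>a\<close> occupies the states from \<open>a\<close> to
  \<open>a + psize p - 1\<close> and is left to the state \<open>a + psize p\<close>.\<close>

fun code :: "prog \<Rightarrow> nat \<Rightarrow> nat \<Rightarrow> nat list \<Rightarrow> nat \<times> (nat \<times> dir) list" where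
  "code (Act i g d) a q ss = (a + 1, (stay ss)[i := (g ss, d)])"
| "code (p ;; p') a q ss =
     (if q < a + psize p then code p a q ss else code p' (a + psize p) q ss)"
| "code (While i S p) a q ss =
     (if q = a then (if ss ! i \<in> S then a + 1 else a + psize p + 2, stay ss)
      else if q < a + 1 + psize p then code p (a + 1) q ss
      else (a, stay ss))"

text \<open>Well-formedness condition under which the compiled table stays within \<open>k\<close>
  tapes and the symbols \<A>.\<close>

fun uses :: "nat set \<Rightarrow> nat \<Rightarrow> prog \<Rightarrow> bool" where
  "uses \<A> k (Act i g d) \<longleftrightarrow> i < k \<and> (\<forall>ss \<in> lists \<A>. length ss = k \<longrightarrow> g ss \<in> \<A>)"
| "uses \<A> k (p ;; p') \<longleftrightarrow> uses \<A> k p \<and> uses \<A> k p'"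
| "uses \<A> k (While i S p) \<longleftrightarrow> i < k \<and> uses \<A> k p"

definition machine :: "nat set \<Rightarrow> nat \<Rightarrow> prog \<Rightarrow> tm" where
  "machine \<A> k p = \<lparr>num_tapes = k, states = {..psize p}, symbols = \<A>, start = 0,
     final = {psize p}, delta = code p 0\<rparr>"

lemma code_valid:
  assumes "uses \<A> k p" and "ss \<in> lists \<A>" and "length ss = k"
    and "a \<le> q" and "q < a + psize p"
  shows "fst (code p a q ss) \<le> a + psize p \<and> length (snd (code p a q ss)) = k \<and>
    fst ` set (snd (code p a q ss)) \<subseteq> \<A>"
  using assms
proof (induction p arbitrary: a)
  case (Act i g d)
  have "fst ` set (stay ss) \<subseteq> \<A>"
    using Act.prems(2) by (auto simp: stay_def)
  moreover have "g ss \<in> \<A>"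
    using Act.prems by simp
  ultimately have "fst ` set ((stay ss)[i := (g ss, d)]) \<subseteq> \<A>"
    using set_update_subset_insert [of "stay ss" i "(g ss, d)"] by force
  then show ?case
    using Act.prems(3) by (simp add: stay_def)
next
  case (Seq p1 p2)
  show ?case
  proof (cases "q < a + psize p1")
    case True
    then show ?thesis
      using Seq.prems Seq.IH(1) [of a] by auto
  next
    case False
    then show ?thesis
      using Seq.prems Seq.IH(2) [of "a + psize p1"] by (auto simp: add.assoc)
  qed
next
  case (While i S p)
  have stay: "length (stay ss) = k" "fst ` set (stay ss) \<subseteq> \<A>"
    using While.prems(2,3) by (auto simp: stay_def)
  consider "q = a" | "a + 1 \<le> q" "q < a + 1 + psize p" | "q = a + 1 + psize p"
    using While.prems(4,5) by fastforce
  then show ?case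
  proof cases
    case 2
    then show ?thesis
      using While.prems While.IH [of "a + 1"] by auto
  qed (use stay in auto)
qed

lemma turing_machine_machine:
  assumes "uses \<A> k p" and "finite \<A>" and "blank \<in> \<A>" and "k \<ge> 1"
  shows "turing_machine (machine \<A> k p)"
proof -
  have *: "fst (code p 0 q ss) \<le> psize p \<and> length (snd (code p 0 q ss)) = k \<and>
      fst ` set (snd (code p 0 q ss)) \<subseteq> \<A>"
    if "q \<le> psize p" "q \<noteq> psize p" "ss \<in> lists \<A>" "length ss = k" for q ss
    using code_valid [of \<A> k p ss 0 q] assms(1) that by simp
  then show ?thesis
    using assms unfolding turing_machine_def machine_def by fastforce
qed

section \<open>Timed runs of embedded code\<close>

definition embedded :: "tm \<Rightarrow> prog \<Rightarrow> nat \<Rightarrow> bool" where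
  "embedded M p a \<longleftrightarrow>
     (\<forall>q. a \<le> q \<and> q < a + psize p \<longrightarrow> q \<notin> final M \<and> delta M q = code p a q)"

text \<open>A Hoare triple with time bound \<open>T\<close>. Quantifying over every machine that
  contains the code, at any address, is what lets triples be composed when \<open>p\<close> becomes
  part of a larger program.\<close>

definition runs :: "prog \<Rightarrow> tape list \<Rightarrow> nat \<Rightarrow> tape list \<Rightarrow> bool" where
  "runs p A T B \<longleftrightarrow>
     (\<forall>M a ts. embedded M p a \<and> list_all2 (\<sim>) ts A \<longrightarrow>
        (\<exists>t ts'. t \<le> T \<and> (step M ^^ t) (a, ts) = (a + psize p, ts') \<and> list_all2 (\<sim>) ts' B))"

lemma runsE:
  assumes "runs p A T B" and "embedded M p a" and "list_all2 (\<sim>) ts A"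
  obtains t ts' where "t \<le> T" "(step M ^^ t) (a, ts) = (a + psize p, ts')"
    "list_all2 (\<sim>) ts' B"
  using assms unfolding runs_def by blast

lemma step_embedded:
  assumes "embedded M p a" and "a \<le> q" and "q < a + psize p"
  shows "step M (q, ts) =
    (fst (code p a q (map scanned ts)), map2 act (snd (code p a q (map scanned ts))) ts)"
  using assms by (auto simp: embedded_def step_def split: prod.split)

lemma map_scanned_cong: "list_all2 (\<sim>) ts A \<Longrightarrow> map scanned ts = map scanned A"
  by (auto simp: list_all2_conv_all_nth intro!: nth_equalityI same_tape_scanned)

lemma stay_cong:
  "list_all2 (\<sim>) ts A \<Longrightarrow> list_all2 (\<sim>) (map2 act (stay (map scanned ts)) ts) A"
  by (auto simp: list_all2_conv_all_nth stay_def intro!: same_tape_stay)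

lemma list_all2_trans_tape:
  "list_all2 (\<sim>) ts A \<Longrightarrow> list_all2 (\<sim>) A B \<Longrightarrow> list_all2 (\<sim>) ts B"
  using list_all2_trans [of "(\<sim>)" "(\<sim>)" "(\<sim>)" ts A B] same_tape_trans by blast

lemma runs_weaken:
  assumes "runs p A T B" and "T \<le> T'" and "list_all2 (\<sim>) B B'"
  shows "runs p A T' B'"
  using assms unfolding runs_def by (meson list_all2_trans_tape order_trans)

lemma runs_time: "runs p A T B \<Longrightarrow> T \<le> T' \<Longrightarrow> runs p A T' B"
  by (rule runs_weaken) (auto simp: list_all2_conv_all_nth)

lemma runs_eq:
  "runs p A T B \<Longrightarrow> A = A' \<Longrightarrow> T \<le> T' \<Longrightarrow> B = B' \<Longrightarrow> runs p A' T' B'"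
  by (auto intro: runs_time)

lemma runs_cong: "runs p A T B \<Longrightarrow> list_all2 (\<sim>) A' A \<Longrightarrow> runs p A' T B"
  unfolding runs_def using list_all2_trans_tape by blast

lemma runs_Act:
  assumes "i < length A" and "s = g (map scanned A)"
  shows "runs (Act i g d) A 1 (A[i := act (s, d) (A ! i)])"
  unfolding runs_def
proof (intro allI impI, elim conjE)
  fix M a ts
  assume emb: "embedded M (Act i g d) a" and eq: "list_all2 (\<sim>) ts A"
  let ?ts' = "map2 act ((stay (map scanned ts))[i := (s, d)]) ts"
  have "(step M ^^ 1) (a, ts) = (a + psize (Act i g d), ?ts')"
    using step_embedded [OF emb, of a ts] map_scanned_cong [OF eq] assms(2) by simp
  moreover have "list_all2 (\<sim>) ?ts' (A[i := act (s, d) (A ! i)])"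
    using eq assms(1)
    by (auto simp: list_all2_conv_all_nth stay_def nth_list_update
        intro!: same_tape_stay same_tape_act)
  ultimately show "\<exists>t ts'. t \<le> 1 \<and> (step M ^^ t) (a, ts) = (a + psize (Act i g d), ts') \<and>
      list_all2 (\<sim>) ts' (A[i := act (s, d) (A ! i)])"
    by blast
qed

lemma funpow_add_apply: "(f ^^ (m + n)) x = (f ^^ n) ((f ^^ m) x)"
  by (metis add.commute comp_apply funpow_add)

lemma runs_Seq:
  assumes "runs p A T B" and "runs p' B T' C"
  shows "runs (p ;; p') A (T + T') C"
  unfolding runs_def
proof (intro allI impI, elim conjE)
  fix M a ts
  assume emb: "embedded M (p ;; p') a" and eq: "list_all2 (\<sim>) ts A"
  have e1: "embedded M p a" and e2: "embedded M p' (a + psize p)"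
    using emb by (auto simp: embedded_def fun_eq_iff)
  obtain t ts' where 1: "t \<le> T" "(step M ^^ t) (a, ts) = (a + psize p, ts')"
    "list_all2 (\<sim>) ts' B"
    by (rule runsE [OF assms(1) e1 eq])
  obtain t' ts'' where 2: "t' \<le> T'"
    "(step M ^^ t') (a + psize p, ts') = (a + psize p + psize p', ts'')"
    "list_all2 (\<sim>) ts'' C"
    by (rule runsE [OF assms(2) e2 1(3)])
  have "(step M ^^ (t + t')) (a, ts) = (a + psize (p ;; p'), ts'')"
    using 1(2) 2(2) by (simp add: funpow_add_apply add.assoc)
  then show "\<exists>t ts'. t \<le> T + T' \<and> (step M ^^ t) (a, ts) = (a + psize (p ;; p'), ts') \<and>
      list_all2 (\<sim>) ts' C"
    using 1(1) 2(1,3) by (meson add_mono)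
qed

lemma runs_While_stop:
  assumes "i < length A" and "scanned (A ! i) \<notin> S"
  shows "runs (While i S p) A 1 A"
  unfolding runs_def
proof (intro allI impI, elim conjE)
  fix M a ts
  assume emb: "embedded M (While i S p) a" and eq: "list_all2 (\<sim>) ts A"
  have "map scanned ts ! i \<notin> S"
    using map_scanned_cong [OF eq] assms by simp
  then have "(step M ^^ 1) (a, ts) =
      (a + psize (While i S p), map2 act (stay (map scanned ts)) ts)"
    using step_embedded [OF emb, of a ts] by simp
  then show "\<exists>t ts'. t \<le> 1 \<and> (step M ^^ t) (a, ts) = (a + psize (While i S p), ts') \<and>
      list_all2 (\<sim>) ts' A"
    using stay_cong [OF eq] by blast
qed

text \<open>One unfolding of a loop; the two extra steps are the test and the jump back. Loops are
  analysed by inductions on their data that apply this rule once per round.\<close>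

lemma runs_While_loop:
  assumes i: "i < length A" "scanned (A ! i) \<in> S"
    and body: "runs p A T B" and rest: "runs (While i S p) B T' C"
  shows "runs (While i S p) A (T + T' + 2) C"
  unfolding runs_def
proof (intro allI impI, elim conjE)
  fix M a ts
  assume emb: "embedded M (While i S p) a" and eq: "list_all2 (\<sim>) ts A"
  \<comment> \<open>Test and jump write back the scanned symbols, which adds at most explicit
    blanks; \<open>stay_cong\<close> absorbs them.\<close>
  define ts0 where "ts0 = map2 act (stay (map scanned ts)) ts"
  have "map scanned ts ! i \<in> S"
    using map_scanned_cong [OF eq] i by simp
  then have 0: "step M (a, ts) = (a + 1, ts0)"
    using step_embedded [OF emb, of a ts] by (simp add: ts0_def)
  have emb_p: "embedded M p (a + 1)"
    using emb by (auto simp: embedded_def fun_eq_iff)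
  obtain t1 ts1 where 1: "t1 \<le> T" "(step M ^^ t1) (a + 1, ts0) = (a + 1 + psize p, ts1)"
    "list_all2 (\<sim>) ts1 B"
    using runsE [OF body emb_p] stay_cong [OF eq] unfolding ts0_def by metis
  define ts2 where "ts2 = map2 act (stay (map scanned ts1)) ts1"
  have 2: "step M (a + 1 + psize p, ts1) = (a, ts2)"
    using step_embedded [OF emb, of "a + 1 + psize p" ts1] by (simp add: ts2_def)
  have ts2: "list_all2 (\<sim>) ts2 B"
    unfolding ts2_def by (rule stay_cong [OF 1(3)])
  obtain t3 ts3 where 3: "t3 \<le> T'" "(step M ^^ t3) (a, ts2) = (a + psize (While i S p), ts3)"
    "list_all2 (\<sim>) ts3 C"
    by (rule runsE [OF rest emb ts2])
  have "(step M ^^ (1 + (t1 + (1 + t3)))) (a, ts) = (a + psize (While i S p), ts3)"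
    unfolding funpow_add_apply using 0 1(2) 2 3(2) by simp
  then show "\<exists>t ts'. t \<le> T + T' + 2 \<and>
      (step M ^^ t) (a, ts) = (a + psize (While i S p), ts') \<and> list_all2 (\<sim>) ts' C"
    using 1(1) 3(1,3) by (intro exI [of _ "1 + (t1 + (1 + t3))"] exI [of _ ts3]) auto
qed

text \<open>The bridge from programs to the machine model. A final configuration is a fixed point of
  \<open>step\<close>, so the output persists until any later time \<open>T'\<close>.\<close>

lemma outputs_within_machine:
  assumes "runs p (([], x) # replicate (k - 1) ([], [])) T B"
    and "B \<noteq> []" and "last B = ([], y)" and "blank \<notin> set y" and "T \<le> T'"
  shows "outputs_within (machine \<A> k p) T' x y"
proof -
  let ?M = "machine \<A> k p" and ?A = "([], x) # replicate (k - 1) ([], [])"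
  have emb: "embedded ?M p 0"
    by (simp add: embedded_def machine_def)
  have eq: "list_all2 (\<sim>) ?A ?A"
    by (simp add: list_all2_conv_all_nth)
  obtain t ts where t: "t \<le> T" "(step ?M ^^ t) (0, ?A) = (0 + psize p, ts)" "list_all2 (\<sim>) ts B"
    by (rule runsE [OF assms(1) emb eq])
  have fix_final: "(step ?M ^^ m) (psize p, ts) = (psize p, ts)" for m
    by (induction m) (auto simp: step_def machine_def)
  obtain m where "T' = t + m"
    using t(1) assms(5) by (metis le_trans le_iff_add)
  then have "(step ?M ^^ T') (initial_config ?M x) = (psize p, ts)"
    using t(2) fix_final by (simp add: funpow_add_apply initial_config_def machine_def)
  moreover have "last ts \<sim> ([], y)"
  proof -
    have "length ts = length B"
      using t(3) by (rule list_all2_lengthD)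
    moreover from this have "ts \<noteq> []"
      using assms(2) by auto
    ultimately show ?thesis
      using list_all2_nthD2 [OF t(3), of "length B - 1"] assms(2,3) by (simp add: last_conv_nth)
  qed
  then have "takeWhile (\<lambda>s. s \<noteq> blank) (snd (last ts)) = takeWhile (\<lambda>s. s \<noteq> blank) y"
    by (intro takeWhile_cells) (simp add: same_tape_def)
  moreover have "takeWhile (\<lambda>s. s \<noteq> blank) y = y"
    using assms(4) by (subst takeWhile_eq_all_conv) metis
  ultimately show ?thesis
    by (simp add: outputs_within_def tape_output_def machine_def)
qed

section \<open>Basic programs: copying, skipping, rewinding\<close>

lemma scanned_simps [simp]: "scanned (l, []) = blank" "scanned (l, x # r) = x"
  by (simp_all add: scanned_def)

lemma scanned_unary [simp]: "scanned (l, replicate k s @ x # r) = (if k = 0 then x else s)"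
  by (cases k) auto

lemma same_tapes_refl [simp]: "list_all2 (\<sim>) A A"
  by (simp add: list_all2_conv_all_nth)

lemma same_tape_pad: "(l @ replicate m blank, r) \<sim> (l, r @ replicate n blank)"
  by (auto simp: same_tape_def cells_def fun_eq_iff nth_append)

lemma same_tape_update:
  assumes "t \<sim> t'" shows "list_all2 (\<sim>) (A[i := t]) (A[i := t'])"
  using assms by (intro list_all2_update_cong) auto

abbreviation put :: "nat \<Rightarrow> nat \<Rightarrow> prog" where
  "put i s \<equiv> Act i (\<lambda>_. s) Go_Right"

abbreviation move :: "nat \<Rightarrow> dir \<Rightarrow> prog" where
  "move i d \<equiv> Act i (\<lambda>ss. ss ! i) d"

abbreviation nonblank :: "nat set" where
  "nonblank \<equiv> - {blank}"

definition copy :: "nat \<Rightarrow> nat \<Rightarrow> prog" where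
  "copy i j = Act j (\<lambda>ss. ss ! i) Go_Right ;; move i Go_Right"

definition copy_while :: "nat \<Rightarrow> nat \<Rightarrow> nat set \<Rightarrow> prog" where
  "copy_while i j S = While i S (copy i j)"

definition skip_while :: "nat \<Rightarrow> nat set \<Rightarrow> prog" where
  "skip_while i S = While i S (move i Go_Right)"

text \<open>The head usually stands on the blank behind a word, where the loop would stop at once;
  hence the first move. The loop ends on the blank before the word, and the last move returns to the
  first letter.\<close>

definition rewind :: "nat \<Rightarrow> prog" where
  "rewind i = move i Go_Left ;; While i nonblank (move i Go_Left) ;; move i Go_Right"

text \<open>Tape \<open>i\<close> is restored, so a word stored there can be appended
  repeatedly.\<close>

definition append_tape :: "nat \<Rightarrow> nat \<Rightarrow> prog" where
  "append_tape i j = copy_while i j nonblank ;; rewind i"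

lemma runs_put:
  assumes "i < length A" and "A ! i = (l, r)"
  shows "runs (put i s) A 1 (A[i := (s # l, tl r)])"
  using runs_Act [of i A s "\<lambda>_. s" Go_Right] assms by simp

lemma runs_move_right:
  assumes "i < length A" and "A ! i = (l, x # r)"
  shows "runs (move i Go_Right) A 1 (A[i := (x # l, r)])"
  using runs_Act [of i A x "\<lambda>ss. ss ! i" Go_Right] assms by simp

lemma runs_copy:
  assumes "i \<noteq> j" "i < length A" "j < length A" "A ! i = (l, x # r)" "A ! j = (l', [])"
  shows "runs (copy i j) A 2 (A[i := (x # l, r), j := (x # l', [])])"
proof -
  have 1: "runs (Act j (\<lambda>ss. ss ! i) Go_Right) A 1 (A[j := (x # l', [])])"
    using runs_Act [of j A x "\<lambda>ss. ss ! i" Go_Right] assms by simp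
  have 2: "runs (move i Go_Right) (A[j := (x # l', [])]) 1 (A[j := (x # l', []), i := (x # l, r)])"
    using assms by (intro runs_move_right) auto
  show ?thesis
    using runs_Seq [OF 1 2] assms(1) by (simp add: copy_def list_update_swap numeral_2_eq_2)
qed

text \<open>Each letter costs two steps of \<open>copy\<close> and two of loop control; the final
  step is the failing test.\<close>

lemma runs_copy_while:
  assumes "i \<noteq> j" "i < length A" "j < length A" "A ! i = (l, xs @ r)" "A ! j = (l', [])"
    and "set xs \<subseteq> S" "scanned (l, r) \<notin> S"
  shows "runs (copy_while i j S) A (4 * length xs + 1)
    (A[i := (rev xs @ l, r), j := (rev xs @ l', [])])"
  using assms
proof (induction xs arbitrary: A l l')
  case Nil
  then have "A[i := (l, r), j := (l', [])] = A"
    by (metis append_Nil list_update_id)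
  with Nil show ?case
    using runs_While_stop [of i A S "copy i j"] by (simp add: copy_while_def scanned_def)
next
  case (Cons x xs)
  let ?B = "A[i := (x # l, xs @ r), j := (x # l', [])]"
  have body: "runs (copy i j) A 2 ?B"
    using Cons.prems by (intro runs_copy) auto
  have rest: "runs (While i S (copy i j)) ?B (4 * length xs + 1)
      (?B[i := (rev xs @ x # l, r), j := (rev xs @ x # l', [])])"
    using Cons.prems Cons.IH [of ?B "x # l" "x # l'"]
    by (simp add: copy_while_def scanned_def)
  have "runs (While i S (copy i j)) A (2 + (4 * length xs + 1) + 2)
      (?B[i := (rev xs @ x # l, r), j := (rev xs @ x # l', [])])"
    using Cons.prems by (intro runs_While_loop [OF _ _ body rest]) auto
  moreover have "?B[i := (rev xs @ x # l, r), j := (rev xs @ x # l', [])] =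
      A[i := (rev (x # xs) @ l, r), j := (rev (x # xs) @ l', [])]"
    using Cons.prems(1) by (simp add: list_update_swap [of j i])
  ultimately have "runs (copy_while i j S) A (2 + (4 * length xs + 1) + 2)
      (A[i := (rev (x # xs) @ l, r), j := (rev (x # xs) @ l', [])])"
    by (simp only: copy_while_def)
  then show ?case
    by (rule runs_time) simp
qed

lemma runs_skip_while:
  assumes "i < length A" "A ! i = (l, xs @ r)" and "set xs \<subseteq> S" "scanned (l, r) \<notin> S"
  shows "runs (skip_while i S) A (4 * length xs + 1) (A[i := (rev xs @ l, r)])"
  using assms
proof (induction xs arbitrary: A l)
  case Nil
  then have "A[i := (l, r)] = A"
    by (metis append_Nil list_update_id)
  with Nil show ?case
    using runs_While_stop [of i A S] by (simp add: skip_while_def scanned_def)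
next
  case (Cons x xs)
  let ?B = "A[i := (x # l, xs @ r)]"
  have body: "runs (move i Go_Right) A 1 ?B"
    using Cons.prems by (intro runs_move_right) auto
  have rest: "runs (skip_while i S) ?B (4 * length xs + 1) (?B[i := (rev xs @ x # l, r)])"
    using Cons.prems Cons.IH [of ?B "x # l"] by (simp add: scanned_def)
  have "runs (skip_while i S) A (1 + (4 * length xs + 1) + 2) (?B[i := (rev xs @ x # l, r)])"
    using Cons.prems unfolding skip_while_def
    by (intro runs_While_loop [OF _ _ body rest [unfolded skip_while_def]]) auto
  then have "runs (skip_while i S) A (1 + (4 * length xs + 1) + 2) (A[i := (rev (x # xs) @ l, r)])"
    by simp
  then show ?case
    by (rule runs_time) simp
qed

lemma runs_rewind:
  assumes "i < length A" "A ! i = (rev xs, r)" and "blank \<notin> set xs"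
  shows "runs (rewind i) A (3 * length xs + 3) (A[i := ([], xs @ r)])"
proof -
  \<comment> \<open>The letters \<open>xs\<close> remain to be passed, the last of them being
    scanned. If none is left, the head is on the blank before the word; this blank may just have
    been created by the move, so the tape is given only up to \<open>\<sim>\<close>.\<close>
  have loop: "runs (While i nonblank (move i Go_Left)) (A[i := t]) (3 * length xs + 1)
      (A[i := ([], blank # xs @ r)])"
    if "t \<sim> (case rev xs of [] \<Rightarrow> ([], blank # r) | x # l \<Rightarrow> (l, x # r))" "blank \<notin> set xs"
    for xs r t
    using that
  proof (induction xs arbitrary: r t rule: rev_induct)
    case Nil
    let ?A = "A[i := ([], blank # r)]"
    have "runs (While i nonblank (move i Go_Left)) ?A 1 ?A"
      using assms(1) by (intro runs_While_stop) auto
    then have "runs (While i nonblank (move i Go_Left)) (A[i := t]) 1 ?A"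
      by (rule runs_cong)
        (use Nil in \<open>auto intro: same_tape_update\<close>)
    then show ?case
      by simp
  next
    case (snoc x xs)
    let ?A = "A[i := (rev xs, x # r)]"
    let ?t = "act (x, Go_Left) (rev xs, x # r)"
    have body: "runs (move i Go_Left) ?A 1 (A[i := ?t])"
      using runs_Act [of i ?A x "\<lambda>ss. ss ! i" Go_Left] assms(1) by simp
    have "?t \<sim> (case rev xs of [] \<Rightarrow> ([], blank # x # r) | y # l \<Rightarrow> (l, y # x # r))"
      by (cases "rev xs") auto
    then have rest: "runs (While i nonblank (move i Go_Left)) (A[i := ?t]) (3 * length xs + 1)
        (A[i := ([], blank # xs @ x # r)])"
      using snoc by (intro snoc.IH) auto
    have "runs (While i nonblank (move i Go_Left)) ?A (1 + (3 * length xs + 1) + 2)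
        (A[i := ([], blank # xs @ x # r)])"
      using assms(1) snoc.prems(2) by (intro runs_While_loop [OF _ _ body rest]) auto
    then have "runs (While i nonblank (move i Go_Left)) (A[i := t]) (1 + (3 * length xs + 1) + 2)
        (A[i := ([], blank # xs @ x # r)])"
      by (rule runs_cong)
        (use snoc.prems in \<open>auto intro: same_tape_update\<close>)
    then show ?case
      by (simp add: eval_nat_numeral)
  qed
  let ?t = "act (scanned (rev xs, r), Go_Left) (rev xs, r)"
  have 1: "runs (move i Go_Left) A 1 (A[i := ?t])"
    using runs_Act [of i A "scanned (rev xs, r)" "\<lambda>ss. ss ! i" Go_Left] assms by simp
  have "?t \<sim> (case rev xs of [] \<Rightarrow> ([], blank # r) | x # l \<Rightarrow> (l, x # r))"
    by (cases "rev xs"; cases r)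
      (auto simp: same_tape_def cells_Cons fun_eq_iff split: nat.split)
  then have 2: "runs (While i nonblank (move i Go_Left)) (A[i := ?t]) (3 * length xs + 1)
      (A[i := ([], blank # xs @ r)])"
    using assms(3) by (rule loop)
  have 3: "runs (move i Go_Right) (A[i := ([], blank # xs @ r)]) 1 (A[i := ([blank], xs @ r)])"
    using runs_move_right [of i "A[i := ([], blank # xs @ r)]" "[]" blank "xs @ r"] assms(1)
    by simp
  have runs: "runs (rewind i) A (1 + ((3 * length xs + 1) + 1)) (A[i := ([blank], xs @ r)])"
    unfolding rewind_def by (intro runs_Seq [OF 1] runs_Seq [OF 2] 3)
  have eq: "list_all2 (\<sim>) (A[i := ([blank], xs @ r)]) (A[i := ([], xs @ r)])"
    using same_tape_pad [of "[]" 1 "xs @ r" 0] by (auto intro: same_tape_update)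
  show ?thesis
    by (rule runs_weaken [OF runs _ eq]) simp
qed

lemma runs_append_tape:
  assumes "i \<noteq> j" "i < length A" "j < length A" "A ! i = ([], xs)" "A ! j = (l, [])"
    and "blank \<notin> set xs"
  shows "runs (append_tape i j) A (7 * length xs + 4) (A[j := (rev xs @ l, [])])"
proof -
  let ?B = "A[i := (rev xs, []), j := (rev xs @ l, [])]"
  have 1: "runs (copy_while i j nonblank) A (4 * length xs + 1) ?B"
    using runs_copy_while [of i j A "[]" xs "[]" l nonblank] assms by auto
  have 2: "runs (rewind i) ?B (3 * length xs + 3) (?B[i := ([], xs)])"
    using runs_rewind [of i ?B xs "[]"] assms by auto
  have eq: "?B[i := ([], xs)] = A[j := (rev xs @ l, [])]"
    using assms(1,4) by (metis list_update_id list_update_overwrite list_update_swap)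
  show ?thesis
    unfolding append_tape_def by (rule runs_time [OF runs_Seq [OF 1 2, unfolded eq]]) simp
qed

lemma lists_nth: "ss \<in> lists \<A> \<Longrightarrow> i < length ss \<Longrightarrow> ss ! i \<in> \<A>"
  by (auto simp: in_lists_conv_set)

lemma uses_copy [simp]:
  "i < k \<Longrightarrow> j < k \<Longrightarrow> uses \<A> k (copy i j)"
  "i < k \<Longrightarrow> j < k \<Longrightarrow> uses \<A> k (copy_while i j S)"
  "i < k \<Longrightarrow> uses \<A> k (skip_while i S)"
  "i < k \<Longrightarrow> uses \<A> k (rewind i)"
  "i < k \<Longrightarrow> j < k \<Longrightarrow> uses \<A> k (append_tape i j)"
  by (auto simp: copy_def copy_while_def skip_while_def rewind_def append_tape_def intro: lists_nth)

section \<open>Computing the system of a word\<close>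

lemma encode_word_simps [simp]:
  "encode_word [] = []"
  "encode_word (k # ks) = replicate k 1 @ 2 # encode_word ks"
  "encode_word (ks @ ks') = encode_word ks @ encode_word ks'"
  by (simp_all add: encode_word_def encode_nat_def)

lemma set_encode_word: "set (encode_word ks) \<subseteq> {1, 2}"
  by (induction ks) auto

lemma blank_notin_encode_word [simp]: "blank \<notin> set (encode_word ks)"
  using set_encode_word [of ks] by auto

text \<open>The continuation \<open>p\<close> ends the chain, as there is no empty program.\<close>

definition puts :: "nat \<Rightarrow> nat list \<Rightarrow> prog \<Rightarrow> prog" where
  "puts i xs p = foldr (\<lambda>s q. put i s ;; q) xs p"

lemma runs_puts:
  assumes "i < length A" "A ! i = (l, [])" "runs p (A[i := (rev xs @ l, [])]) T B"
  shows "runs (puts i xs p) A (length xs + T) B"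
  using assms
proof (induction xs arbitrary: A l)
  case Nil
  then show ?case
    by (metis append_Nil foldr.simps(1) id_apply list.size(3) list_update_id plus_nat.add_0
        puts_def rev.simps(1))
next
  case (Cons x xs)
  have 1: "runs (put i x) A 1 (A[i := (x # l, [])])"
    using runs_put [of i A l "[]" x] Cons.prems by simp
  have 2: "runs (puts i xs p) (A[i := (x # l, [])]) (length xs + T) B"
    using Cons.prems by (intro Cons.IH [of _ "x # l"]) auto
  show ?case
    using runs_Seq [OF 1 2] by (simp add: puts_def)
qed

text \<open>The letters of \<open>w\<close> are shifted by 2, which makes room for \<open>s = 0\<close> and \<open>t = 1\<close> and lets a
  machine compute the system in one pass.\<close>

definition system_of_word :: "nat \<times> nat list \<Rightarrow> nat \<times> nat equation list" where
  "system_of_word = (\<lambda>(n, w). (n + 2, [(map (\<lambda>k. k + 2) w, [0, 0, 0, 1, 1]), ([0, 1], [1, 0])]))"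

text \<open>The part of the encoded system that does not depend on the instance: the separator and
  right side of the first equation, then the second equation.\<close>

definition system_tail :: "nat list" where
  "system_tail = 3 # encode_word [0, 0, 0, 1, 1] @ 4 # encode_equation ([0, 1], [1, 0])"

text \<open>Prefixes every unary number with two strokes. The leading alphabet size needs no special
  treatment, because \<open>n\<close> also becomes \<open>n + 2\<close>.\<close>

definition shift_letters :: prog where
  "shift_letters = While 0 {1, 2} (put 1 1 ;; put 1 1 ;; copy_while 0 1 {1} ;; copy 0 1)"

definition system_prog :: prog where
  "system_prog = shift_letters ;; puts 1 system_tail (rewind 1)"

text \<open>A number \<open>k\<close> occupies \<open>k + 1\<close> cells and costs
  \<open>4 * k + 7\<close> steps, loop control included.\<close>

lemma runs_shift_letters:
  "runs shift_letters [(l, encode_word ks), (o', [])] (7 * length (encode_word ks) + 1)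
    [(rev (encode_word ks) @ l, []), (rev (encode_word (map (\<lambda>k. k + 2) ks)) @ o', [])]"
proof (induction ks arbitrary: l o')
  case Nil
  show ?case
    using runs_While_stop [of 0 "[(l, []), (o', [])]" "{1, 2}"] by (simp add: shift_letters_def)
next
  case (Cons k ks)
  let ?e = "encode_word ks"
  let ?A = "[(l, replicate k 1 @ 2 # ?e), (o', [])]"
  let ?r = "replicate k 1"
  have 1: "runs (put 1 1) ?A 1 [(l, ?r @ 2 # ?e), (1 # o', [])]"
    using runs_put [of 1 ?A o' "[]" 1] by simp
  have 2: "runs (put 1 1) [(l, ?r @ 2 # ?e), (1 # o', [])] 1 [(l, ?r @ 2 # ?e), (1 # 1 # o', [])]"
    using runs_put [of 1 "[(l, ?r @ 2 # ?e), (1 # o', [])]" "1 # o'" "[]" 1] by simp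
  have 3: "runs (copy_while 0 1 {1}) [(l, ?r @ 2 # ?e), (1 # 1 # o', [])] (4 * k + 1)
     [(?r @ l, 2 # ?e), (?r @ 1 # 1 # o', [])]"
    using runs_copy_while [of 0 1 "[(l, ?r @ 2 # ?e), (1 # 1 # o', [])]" l ?r "2 # ?e" "1 # 1 # o'" "{1}"]
    by (simp add: set_replicate_conv_if)
  have 4: "runs (copy 0 1) [(?r @ l, 2 # ?e), (?r @ 1 # 1 # o', [])] 2
     [(2 # ?r @ l, ?e), (2 # ?r @ 1 # 1 # o', [])]"
    using runs_copy [of 0 1 "[(?r @ l, 2 # ?e), (?r @ 1 # 1 # o', [])]" "?r @ l" 2 ?e] by simp
  have body: "runs (put 1 1 ;; put 1 1 ;; copy_while 0 1 {1} ;; copy 0 1) ?A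
      (1 + (1 + ((4 * k + 1) + 2))) [(2 # ?r @ l, ?e), (2 # ?r @ 1 # 1 # o', [])]"
    by (intro runs_Seq [OF 1] runs_Seq [OF 2] runs_Seq [OF 3] 4)
  have "runs shift_letters ?A ((1 + (1 + ((4 * k + 1) + 2))) + (7 * length ?e + 1) + 2)
      [(rev ?e @ 2 # ?r @ l, []),
       (rev (encode_word (map (\<lambda>k. k + 2) ks)) @ 2 # ?r @ 1 # 1 # o', [])]"
    unfolding shift_letters_def
    by (rule runs_While_loop [OF _ _ body Cons.IH [unfolded shift_letters_def]])
      auto
  then show ?case
    by (rule runs_eq) (simp_all add: replicate_app_Cons_same)
qed

lemma encode_EqSatCF_system:
  "encode (EqSatCF \<Gamma>) (system_of_word (n, w)) = encode_word (map (\<lambda>k. k + 2) (n # w)) @ system_tail"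
  by (simp add: EqSatCF_def system_of_word_def system_tail_def encode_equation_def encode_nat_def)

lemma encode_NonPrim: "encode (NonPrim \<Gamma>) (n, w) = encode_word (n # w)"
  by (simp add: NonPrim_def encode_nat_def)

lemma uses_puts:
  "i < k \<Longrightarrow> set xs \<subseteq> \<A> \<Longrightarrow> uses \<A> k p \<Longrightarrow> uses \<A> k (puts i xs p)"
  by (induction xs) (auto simp: puts_def)

text \<open>A block of length \<open>k + 1\<close> grows to length
  \<open>k + 3 \<le> 3 * (k + 1)\<close>.\<close>

lemma length_encode_word_shift:
  "length (encode_word (map (\<lambda>k. k + 2) ks)) \<le> 3 * length (encode_word ks)"
  by (induction ks) auto

lemma polytime_system_of_word:
  "polytime_computable (NonPrim \<Gamma>) (EqSatCF \<Gamma>) system_of_word"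
proof -
  let ?M = "machine {..4} 2 system_prog"
  have tail: "set system_tail \<subseteq> {1..4}" "length system_tail \<le> 30"
    by (simp_all add: system_tail_def encode_equation_def)
  have "uses {..4} 2 system_prog"
    unfolding system_prog_def shift_letters_def using tail(1)
    by (auto intro!: uses_puts)
  then have M: "turing_machine ?M"
    by (rule turing_machine_machine) auto
  \<comment> \<open>For input length \<open>L\<close>, shifting takes \<open>7 * L + 1\<close>
    steps, the tail at most 30, and rewinding an output of at most \<open>3 * L + 30\<close> symbols
    accounts for the rest.\<close>
  have "outputs_within ?M (poly [:134, 16:] (length x)) x (encode (EqSatCF \<Gamma>) (system_of_word I))"
    if x: "x = encode (NonPrim \<Gamma>) I" for I x
  proof -
    obtain n w where I: "I = (n, w)"
      by fastforce
    let ?ks = "n # w"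
    let ?y = "encode_word (map (\<lambda>k. k + 2) ?ks) @ system_tail"
    have x: "x = encode_word ?ks" and y: "encode (EqSatCF \<Gamma>) (system_of_word I) = ?y"
      unfolding x I by (rule encode_NonPrim, rule encode_EqSatCF_system)
    let ?in = "(rev x, [])"
    have blank: "blank \<notin> set ?y"
      using tail(1) by (auto simp del: list.map(2))
    have 1: "runs shift_letters [([], x), ([], [])] (7 * length x + 1)
        [?in, (rev (encode_word (map (\<lambda>k. k + 2) ?ks)), [])]"
      using runs_shift_letters [of "[]" ?ks "[]"] by (simp only: x append_Nil2)
    have 3: "runs (rewind 1) [?in, (rev ?y, [])] (3 * length ?y + 3) [?in, ([], ?y)]"
      using runs_rewind [of 1 "[?in, (rev ?y, [])]" ?y "[]"] blank by simp
    have 2: "runs (puts 1 system_tail (rewind 1))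
        [?in, (rev (encode_word (map (\<lambda>k. k + 2) ?ks)), [])]
        (length system_tail + (3 * length ?y + 3)) [?in, ([], ?y)]"
      using 3 by (intro runs_puts [of _ _ "rev (encode_word (map (\<lambda>k. k + 2) ?ks))"]) simp_all
    have run: "runs system_prog (([], x) # replicate (2 - 1) ([], []))
        (7 * length x + 1 + (length system_tail + (3 * length ?y + 3))) [?in, ([], ?y)]"
      using runs_Seq [OF 1 2] by (simp add: system_prog_def)
    have time: "7 * length x + 1 + (length system_tail + (3 * length ?y + 3)) \<le>
        poly [:134, 16:] (length x)"
      using length_encode_word_shift [of ?ks] tail(2) unfolding x by simp
    show ?thesis
      unfolding y by (rule outputs_within_machine [OF run _ _ blank time]) simp_all
  qed
  moreover have "encode (NonPrim \<Gamma>) I \<in> lists (symbols ?M - {blank})" for I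
    using set_encode_word by (cases I) (force simp: encode_NonPrim machine_def simp del: encode_word_simps)
  ultimately show ?thesis
    unfolding polytime_computable_def using M by blast
qed

section \<open>Computing the word of a system\<close>

text \<open>The sides are included so that, for every morphism \<open>h\<close>, the length of
  \<open>h z\<close> bounds the total length of the images of all sides. This is the range of shifts
  that the marker has to exclude.\<close>

definition letters_of_system :: "nat \<Rightarrow> nat equation list \<Rightarrow> nat list" where
  "letters_of_system n E = [0..<n] @ concat (map (\<lambda>(u, v). u @ v) E)"

definition marker :: "'a list \<Rightarrow> 'a list" where
  "marker z = z @ z @ concat (map (\<lambda>a. a # z) z)"

definition side :: "'a list \<Rightarrow> 'a list list \<Rightarrow> 'a list" where
  "side g us = g @ concat (map (\<lambda>u. u @ g) us)"

text \<open>The word \<open>z = letters_of_system n E\<close> contains every letter of the alphabet,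
  even those that do not occur in the system: otherwise the word could have a nonperiodic
  imprimitive image although all solutions are periodic.\<close>

definition word_of_system :: "nat \<times> nat equation list \<Rightarrow> nat \<times> nat list" where
  "word_of_system = (\<lambda>(n, E).
     let g = marker (letters_of_system n E);
         a = side g (map fst E);
         b = side g (map snd E)
     in (n, a @ a @ a @ a @ b))"

text \<open>
  Tape 0 holds the input, tape 1 the next letter in unary, tapes 2 and 3 the word \<open>z\<close>, tape 4 the
  marker and tape 5 the output. The leading number of the input is erased while it is read, so that
  rewinding tape 0 afterwards leads to the first equation.
\<close>

definition list_letters :: prog where
  "list_letters = While 0 {1} (put 5 1 ;; put 0 blank ;; append_tape 1 2 ;; put 2 2 ;;
     move 1 Go_Left ;; Act 1 (\<lambda>_. 1) Stay)"

definition collect_words :: prog where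
  "collect_words = While 0 {1, 2, 3, 4} (copy_while 0 2 {1, 2} ;; move 0 Go_Right)"

text \<open>Two copies of \<open>z\<close> are in use: tape 3 is read letter by letter, and tape 2
  is appended after each letter.\<close>

definition spread_letters :: prog where
  "spread_letters = While 3 {1, 2} (copy_while 3 4 {1} ;; copy 3 4 ;; append_tape 2 4)"

definition left_sides :: prog where
  "left_sides = While 0 {1, 2, 3} (copy_while 0 5 {1, 2} ;; skip_while 0 {1, 2, 3} ;;
     move 0 Go_Right ;; append_tape 4 5)"

definition right_sides :: prog where
  "right_sides = While 0 {1, 2, 3} (skip_while 0 {1, 2} ;; move 0 Go_Right ;;
     copy_while 0 5 {1, 2} ;; move 0 Go_Right ;; append_tape 4 5)"

definition side_prog :: "prog \<Rightarrow> prog" where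
  "side_prog p = append_tape 4 5 ;; p ;; rewind 0"

definition letters_prog :: prog where
  "letters_prog = list_letters ;; put 5 2 ;; put 0 blank ;; collect_words ;; rewind 0 ;; rewind 2 ;;
     append_tape 2 3 ;; rewind 3"

definition marker_prog :: prog where
  "marker_prog = append_tape 2 4 ;; append_tape 2 4 ;; spread_letters ;; rewind 4"

definition sides_prog :: prog where
  "sides_prog = side_prog left_sides ;; side_prog left_sides ;; side_prog left_sides ;;
     side_prog left_sides ;; side_prog right_sides"

definition word_prog :: prog where
  "word_prog = letters_prog ;; marker_prog ;; sides_prog ;; rewind 5"

section \<open>Correctness and running time of the loops\<close>

lemma runs_list_letters:
  assumes "i + m \<le> n"
  shows "runs list_letters
    [([], replicate m 1 @ 2 # e), ([], replicate i 1), (zl, []), d, d', (ol, [])]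
    (m * (7 * n + 11) + 1)
    [([], 2 # e), ([], replicate (i + m) 1), (rev (encode_word [i..<i + m]) @ zl, []),
     d, d', (replicate m 1 @ ol, [])]"
  using assms
proof (induction m arbitrary: i zl ol)
  case 0
  show ?case
    unfolding list_letters_def by (rule runs_eq [OF runs_While_stop]) auto
next
  case (Suc m)
  let ?i = "replicate i 1" and ?e = "replicate m 1 @ 2 # e"
  let ?A = "[([], 1 # ?e), ([], ?i), (zl, []), d, d', (ol, [])]"
  have 1: "runs (put 5 1) ?A 1 [([], 1 # ?e), ([], ?i), (zl, []), d, d', (1 # ol, [])]"
    by (rule runs_eq [OF runs_put]) auto
  have 2: "runs (put 0 blank) [([], 1 # ?e), ([], ?i), (zl, []), d, d', (1 # ol, [])] 1
      [([blank], ?e), ([], ?i), (zl, []), d, d', (1 # ol, [])]"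
    by (rule runs_eq [OF runs_put]) auto
  have 3: "runs (append_tape 1 2) [([blank], ?e), ([], ?i), (zl, []), d, d', (1 # ol, [])]
      (7 * i + 4) [([blank], ?e), ([], ?i), (?i @ zl, []), d, d', (1 # ol, [])]"
    by (rule runs_eq [OF runs_append_tape]) auto
  have 4: "runs (put 2 2) [([blank], ?e), ([], ?i), (?i @ zl, []), d, d', (1 # ol, [])]
      1 [([blank], ?e), ([], ?i), (2 # ?i @ zl, []), d, d', (1 # ol, [])]"
    by (rule runs_eq [OF runs_put]) auto
  \<comment> \<open>The counter grows at its left end: a stroke on the blank before it leaves the
    head on the first cell again.\<close>
  let ?t = "act (scanned ([], ?i), Go_Left) ([], ?i)"
  have 5: "runs (move 1 Go_Left) [([blank], ?e), ([], ?i), (2 # ?i @ zl, []), d, d', (1 # ol, [])]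
      1 [([blank], ?e), ?t, (2 # ?i @ zl, []), d, d', (1 # ol, [])]"
    by (rule runs_eq [OF runs_Act]) auto
  have 6: "runs (Act 1 (\<lambda>_. 1) Stay) [([blank], ?e), ?t, (2 # ?i @ zl, []), d, d', (1 # ol, [])]
      1 [([blank], ?e), act (1, Stay) ?t, (2 # ?i @ zl, []), d, d', (1 # ol, [])]"
    by (rule runs_eq [OF runs_Act]) auto
  let ?B = "[([], ?e), ([], replicate (Suc i) 1), (2 # ?i @ zl, []), d, d', (1 # ol, [])]"
  have "([blank], ?e) \<sim> ([], ?e)"
    using same_tape_pad [of "[]" 1 ?e 0] by simp
  moreover have "act (1, Stay) ?t \<sim> ([], replicate (Suc i) 1)"
    by (cases i) (auto simp: same_tape_def cells_Cons fun_eq_iff split: nat.split)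
  ultimately have 7: "list_all2 (\<sim>)
      [([blank], ?e), act (1, Stay) ?t, (2 # ?i @ zl, []), d, d', (1 # ol, [])] ?B"
    by simp
  have body: "runs (put 5 1 ;; put 0 blank ;; append_tape 1 2 ;; put 2 2 ;;
     move 1 Go_Left ;; Act 1 (\<lambda>_. 1) Stay) ?A (1 + (1 + ((7 * i + 4) + (1 + (1 + 1))))) ?B"
    by (rule runs_weaken [OF _ order_refl 7])
      (intro runs_Seq [OF 1] runs_Seq [OF 2] runs_Seq [OF 3] runs_Seq [OF 4] runs_Seq [OF 5] 6)
  have rest: "runs list_letters ?B (m * (7 * n + 11) + 1)
    [([], 2 # e), ([], replicate (Suc i + m) 1),
     (rev (encode_word [Suc i..<Suc i + m]) @ 2 # ?i @ zl, []),
     d, d', (replicate m 1 @ 1 # ol, [])]"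
    using Suc.prems by (intro Suc.IH) simp
  have "runs list_letters ?A
     ((1 + (1 + ((7 * i + 4) + (1 + (1 + 1))))) + (m * (7 * n + 11) + 1) + 2)
     [([], 2 # e), ([], replicate (Suc i + m) 1),
     (rev (encode_word [Suc i..<Suc i + m]) @ 2 # ?i @ zl, []),
     d, d', (replicate m 1 @ 1 # ol, [])]"
    unfolding list_letters_def
    by (rule runs_While_loop [OF _ _ body rest [unfolded list_letters_def]]) auto
  moreover have "[i..<i + Suc m] = i # [Suc i..<Suc i + m]"
    by (simp add: upt_rec)
  \<comment> \<open>A round costs \<open>7 * i + 11\<close> steps, since the counter is copied and
    rewound, and \<open>i < n\<close> holds as long as a stroke remains.\<close>
  ultimately show ?case
    using Suc.prems by (elim runs_eq) (auto simp: replicate_app_Cons_same)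
qed

text \<open>The equations are seen as blocks \<open>w\<close>, each closed by a separator
  \<open>c\<close>; left and right sides are treated alike here.\<close>

lemma runs_collect_words:
  assumes "\<And>w c. (w, c) \<in> set bs \<Longrightarrow> set w \<subseteq> {1, 2} \<and> c \<in> {3, 4}"
  shows "runs collect_words
    [(l, concat (map (\<lambda>(w, c). w @ [c]) bs)), C, (zl, []), d, d', d'']
    (4 * length (concat (map (\<lambda>(w, c). w @ [c]) bs)) + 1)
    [(rev (concat (map (\<lambda>(w, c). w @ [c]) bs)) @ l, []), C,
     (rev (concat (map fst bs)) @ zl, []), d, d', d'']"
  using assms
proof (induction bs arbitrary: l zl)
  case Nil
  show ?case
    unfolding collect_words_def by (rule runs_eq [OF runs_While_stop]) auto
next
  case (Cons b bs)
  obtain w c where b: "b = (w, c)"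
    by fastforce
  have w: "set w \<subseteq> {1, 2}" and c: "c \<in> {3, 4}"
    using Cons.prems [of w c] b by auto
  let ?r = "concat (map (\<lambda>(w, c). w @ [c]) bs)"
  let ?A = "[(l, w @ c # ?r), C, (zl, []), d, d', d'']"
  have 1: "runs (copy_while 0 2 {1, 2}) ?A (4 * length w + 1)
      [(rev w @ l, c # ?r), C, (rev w @ zl, []), d, d', d'']"
    by (rule runs_eq [OF runs_copy_while [where xs = w and r = "c # ?r" and l = l and l' = zl]])
      (use w c in auto)
  have 2: "runs (move 0 Go_Right) [(rev w @ l, c # ?r), C, (rev w @ zl, []), d, d', d''] 1
      [(c # rev w @ l, ?r), C, (rev w @ zl, []), d, d', d'']"
    by (rule runs_eq [OF runs_move_right]) auto
  have body: "runs (copy_while 0 2 {1, 2} ;; move 0 Go_Right) ?A ((4 * length w + 1) + 1)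
      [(c # rev w @ l, ?r), C, (rev w @ zl, []), d, d', d'']"
    by (rule runs_Seq [OF 1 2])
  have rest: "runs collect_words [(c # rev w @ l, ?r), C, (rev w @ zl, []), d, d', d'']
      (4 * length ?r + 1)
      [(rev ?r @ c # rev w @ l, []), C, (rev (concat (map fst bs)) @ rev w @ zl, []), d, d', d'']"
    using Cons.prems by (intro Cons.IH) auto
  \<comment> \<open>A side may be empty; the head then already scans the separator, so the loop test
    must accept it.\<close>
  have "scanned (l, w @ c # ?r) \<in> {1, 2, 3, 4}"
    using w c by (cases w) auto
  then have "runs collect_words ?A (((4 * length w + 1) + 1) + (4 * length ?r + 1) + 2)
      [(rev ?r @ c # rev w @ l, []), C, (rev (concat (map fst bs)) @ rev w @ zl, []), d, d', d'']"
    unfolding collect_words_def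
    by (intro runs_While_loop [OF _ _ body rest [unfolded collect_words_def]]) auto
  then show ?case
    by (rule runs_eq) (auto simp: b)
qed

text \<open>A letter \<open>k\<close> takes \<open>k + 1\<close> cells and costs
  \<open>4 * k + 7 * length z + 9\<close> steps, which is within the bound per cell.\<close>

lemma runs_spread_letters:
  assumes "blank \<notin> set z"
  shows "runs spread_letters [d, d', ([], z), (l, encode_word ks), (gl, []), d'']
    (length (encode_word ks) * (7 * length z + 9) + 1)
    [d, d', ([], z), (rev (encode_word ks) @ l, []),
     (rev (concat (map (\<lambda>k. encode_word [k] @ z) ks)) @ gl, []), d'']"
proof (induction ks arbitrary: l gl)
  case Nil
  show ?case
    unfolding spread_letters_def by (rule runs_eq [OF runs_While_stop]) auto
next
  case (Cons k ks)
  let ?r = "encode_word ks" and ?k = "replicate k 1"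
  let ?A = "[d, d', ([], z), (l, ?k @ 2 # ?r), (gl, []), d'']"
  have 1: "runs (copy_while 3 4 {1}) ?A (4 * k + 1)
      [d, d', ([], z), (?k @ l, 2 # ?r), (?k @ gl, []), d'']"
    by (rule runs_eq [OF runs_copy_while [where xs = ?k and r = "2 # ?r" and l = l and l' = gl]])
      (auto simp: set_replicate_conv_if)
  have 2: "runs (copy 3 4) [d, d', ([], z), (?k @ l, 2 # ?r), (?k @ gl, []), d''] 2
      [d, d', ([], z), (2 # ?k @ l, ?r), (2 # ?k @ gl, []), d'']"
    by (rule runs_eq [OF runs_copy]) auto
  have 3: "runs (append_tape 2 4) [d, d', ([], z), (2 # ?k @ l, ?r), (2 # ?k @ gl, []), d'']
      (7 * length z + 4) [d, d', ([], z), (2 # ?k @ l, ?r), (rev z @ 2 # ?k @ gl, []), d'']"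
    by (rule runs_eq [OF runs_append_tape]) (use assms in auto)
  have body: "runs (copy_while 3 4 {1} ;; copy 3 4 ;; append_tape 2 4) ?A
      ((4 * k + 1) + (2 + (7 * length z + 4)))
      [d, d', ([], z), (2 # ?k @ l, ?r), (rev z @ 2 # ?k @ gl, []), d'']"
    by (intro runs_Seq [OF 1] runs_Seq [OF 2] 3)
  have "runs spread_letters ?A (((4 * k + 1) + (2 + (7 * length z + 4))) +
      (length ?r * (7 * length z + 9) + 1) + 2)
     [d, d', ([], z), (rev ?r @ 2 # ?k @ l, []),
      (rev (concat (map (\<lambda>k. encode_word [k] @ z) ks)) @ rev z @ 2 # ?k @ gl, []), d'']"
    unfolding spread_letters_def
    by (intro runs_While_loop [OF _ _ body Cons.IH [unfolded spread_letters_def]]) auto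
  then show ?case
    by (rule runs_eq) (auto simp: algebra_simps)
qed

lemma encode_equation_simp [simp]:
  "encode_equation (u, v) = encode_word u @ 3 # encode_word v @ [4]"
  by (simp add: encode_equation_def)

lemma scanned_encode_word [simp]:
  "scanned (l, encode_word u @ x # r) \<in> {1, 2, x}"
  using set_encode_word [of u] by (cases "encode_word u") auto

lemma runs_left_sides:
  assumes "blank \<notin> set g"
  shows "runs left_sides
    [(l, concat (map encode_equation E)), d, d', d'', ([], g), (ol, [])]
    (length (concat (map encode_equation E)) * (7 * length g + 13) + 1)
    [(rev (concat (map encode_equation E)) @ l, []), d, d', d'', ([], g),
     (rev (concat (map (\<lambda>u. encode_word u @ g) (map fst E))) @ ol, [])]"
proof (induction E arbitrary: l ol)
  case Nil
  show ?case
    unfolding left_sides_def by (rule runs_eq [OF runs_While_stop]) auto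
next
  case (Cons eq E)
  obtain x y where eq: "eq = (x, y)"
    by fastforce
  let ?r = "concat (map encode_equation E)" and ?u = "encode_word x" and ?v = "encode_word y"
  let ?S = "\<lambda>i o'. [i, d, d', d'', ([], g), o']"
  let ?i1 = "(rev ?u @ l, 3 # ?v @ 4 # ?r)" and ?o1 = "(rev ?u @ ol, [])"
  have 1: "runs (copy_while 0 5 {1, 2}) (?S (l, ?u @ 3 # ?v @ 4 # ?r) (ol, [])) (4 * length ?u + 1)
      (?S ?i1 ?o1)"
    by (rule runs_eq [OF runs_copy_while
          [where xs = ?u and r = "3 # ?v @ 4 # ?r" and l = l and l' = ol]])
      (use set_encode_word in auto)
  let ?i2 = "(rev ?v @ 3 # rev ?u @ l, 4 # ?r)"
  have 2: "runs (skip_while 0 {1, 2, 3}) (?S ?i1 ?o1) (4 * length (3 # ?v) + 1) (?S ?i2 ?o1)"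
    by (rule runs_eq [OF runs_skip_while
          [where xs = "3 # ?v" and r = "4 # ?r" and l = "rev ?u @ l"]])
      (use set_encode_word [of y] in auto)
  let ?i3 = "(4 # rev ?v @ 3 # rev ?u @ l, ?r)"
  have 3: "runs (move 0 Go_Right) (?S ?i2 ?o1) 1 (?S ?i3 ?o1)"
    by (rule runs_eq [OF runs_move_right]) auto
  let ?o2 = "(rev g @ rev ?u @ ol, [])"
  have 4: "runs (append_tape 4 5) (?S ?i3 ?o1) (7 * length g + 4) (?S ?i3 ?o2)"
    by (rule runs_eq [OF runs_append_tape]) (use assms in auto)
  note body = runs_Seq [OF 1 runs_Seq [OF 2 runs_Seq [OF 3 4]]]
  have scan: "scanned (l, ?u @ 3 # ?v @ 4 # ?r) \<in> {1, 2, 3}"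
    by (rule scanned_encode_word)
  have "runs left_sides (?S (l, ?u @ 3 # ?v @ 4 # ?r) (ol, []))
     ((4 * length ?u + 1 + (4 * length (3 # ?v) + 1 + (1 + (7 * length g + 4)))) +
      (length ?r * (7 * length g + 13) + 1) + 2)
     (?S (rev ?r @ 4 # rev ?v @ 3 # rev ?u @ l, [])
       (rev (concat (map (\<lambda>u. encode_word u @ g) (map fst E))) @ rev g @ rev ?u @ ol, []))"
    unfolding left_sides_def
    by (rule runs_While_loop [OF _ _ body Cons.IH [unfolded left_sides_def]]) (use scan in auto)
  then show ?case
    by (rule runs_eq) (auto simp: eq algebra_simps)
qed

lemma runs_right_sides:
  assumes "blank \<notin> set g"
  shows "runs right_sides
    [(l, concat (map encode_equation E)), d, d', d'', ([], g), (ol, [])]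
    (length (concat (map encode_equation E)) * (7 * length g + 13) + 1)
    [(rev (concat (map encode_equation E)) @ l, []), d, d', d'', ([], g),
     (rev (concat (map (\<lambda>u. encode_word u @ g) (map snd E))) @ ol, [])]"
proof (induction E arbitrary: l ol)
  case Nil
  show ?case
    unfolding right_sides_def by (rule runs_eq [OF runs_While_stop]) auto
next
  case (Cons eq E)
  obtain x y where eq: "eq = (x, y)"
    by fastforce
  let ?r = "concat (map encode_equation E)" and ?u = "encode_word x" and ?v = "encode_word y"
  let ?S = "\<lambda>i o'. [i, d, d', d'', ([], g), o']"
  let ?i1 = "(rev ?u @ l, 3 # ?v @ 4 # ?r)"
  have 1: "runs (skip_while 0 {1, 2}) (?S (l, ?u @ 3 # ?v @ 4 # ?r) (ol, [])) (4 * length ?u + 1)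
      (?S ?i1 (ol, []))"
    by (rule runs_eq [OF runs_skip_while
          [where xs = ?u and r = "3 # ?v @ 4 # ?r" and l = l]])
      (use set_encode_word in auto)
  let ?i2 = "(3 # rev ?u @ l, ?v @ 4 # ?r)"
  have 2: "runs (move 0 Go_Right) (?S ?i1 (ol, [])) 1 (?S ?i2 (ol, []))"
    by (rule runs_eq [OF runs_move_right]) auto
  let ?i3 = "(rev ?v @ 3 # rev ?u @ l, 4 # ?r)" and ?o1 = "(rev ?v @ ol, [])"
  have 3: "runs (copy_while 0 5 {1, 2}) (?S ?i2 (ol, [])) (4 * length ?v + 1) (?S ?i3 ?o1)"
    by (rule runs_eq [OF runs_copy_while
          [where xs = ?v and r = "4 # ?r" and l = "3 # rev ?u @ l" and l' = ol]])
      (use set_encode_word in auto)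
  let ?i4 = "(4 # rev ?v @ 3 # rev ?u @ l, ?r)"
  have 4: "runs (move 0 Go_Right) (?S ?i3 ?o1) 1 (?S ?i4 ?o1)"
    by (rule runs_eq [OF runs_move_right]) auto
  let ?o2 = "(rev g @ rev ?v @ ol, [])"
  have 5: "runs (append_tape 4 5) (?S ?i4 ?o1) (7 * length g + 4) (?S ?i4 ?o2)"
    by (rule runs_eq [OF runs_append_tape]) (use assms in auto)
  note body = runs_Seq [OF 1 runs_Seq [OF 2 runs_Seq [OF 3 runs_Seq [OF 4 5]]]]
  have scan: "scanned (l, ?u @ 3 # ?v @ 4 # ?r) \<in> {1, 2, 3}"
    by (rule scanned_encode_word)
  have "runs right_sides (?S (l, ?u @ 3 # ?v @ 4 # ?r) (ol, []))
     ((4 * length ?u + 1 + (1 + (4 * length ?v + 1 + (1 + (7 * length g + 4))))) +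
      (length ?r * (7 * length g + 13) + 1) + 2)
     (?S (rev ?r @ 4 # rev ?v @ 3 # rev ?u @ l, [])
       (rev (concat (map (\<lambda>u. encode_word u @ g) (map snd E))) @ rev g @ rev ?v @ ol, []))"
    unfolding right_sides_def
    by (rule runs_While_loop [OF _ _ body Cons.IH [unfolded right_sides_def]]) (use scan in auto)
  then show ?case
    by (rule runs_eq) (auto simp: eq algebra_simps)
qed

lemma encode_word_concat: "encode_word (concat xs) = concat (map encode_word xs)"
  by (induction xs) auto

lemma encode_EqSatCF:
  "encode (EqSatCF \<Gamma>) (n, E) = replicate n 1 @ 2 # concat (map encode_equation E)"
  by (simp add: EqSatCF_def encode_nat_def)

lemma set_encode_equations: "set (concat (map encode_equation E)) \<subseteq> {1..4}"
proof (induction E)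
  case (Cons eq E)
  have "set (encode_word u) \<subseteq> {1..4}" for u
    using set_encode_word [of u] by auto
  then show ?case
    using Cons by (simp add: encode_equation_def)
qed simp

lemma blank_notin_encode_equations: "blank \<notin> set (concat (map encode_equation E))"
  using set_encode_equations [of E] by auto

lemma runs_letters_prog:
  fixes n E defines "e \<equiv> concat (map encode_equation E)"
    and "z \<equiv> encode_word (letters_of_system n E)"
  shows "runs letters_prog (([], replicate n 1 @ 2 # e) # replicate 5 ([], []))
    (n * (7 * n + 11) + 7 * length e + 13 * length z + 17)
    [([], e), ([], replicate n 1), ([], z), ([], z), ([], []), (2 # replicate n 1, [])]"
proof -
  let ?n = "replicate n (1 :: nat)" and ?z0 = "encode_word [0..<n]"
  have 1: "runs list_letters (([], ?n @ 2 # e) # replicate 5 ([], [])) (n * (7 * n + 11) + 1)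
      [([], 2 # e), ([], ?n), (rev ?z0, []), ([], []), ([], []), (?n, [])]"
    by (rule runs_eq [OF runs_list_letters [of 0 n n e "[]" "([], [])" "([], [])" "[]"]])
      (auto simp: eval_nat_numeral)
  have 2: "runs (put 5 2) [([], 2 # e), ([], ?n), (rev ?z0, []), ([], []), ([], []), (?n, [])]
      1 [([], 2 # e), ([], ?n), (rev ?z0, []), ([], []), ([], []), (2 # ?n, [])]"
    by (rule runs_eq [OF runs_put]) auto
  have 3: "runs (put 0 blank)
      [([], 2 # e), ([], ?n), (rev ?z0, []), ([], []), ([], []), (2 # ?n, [])]
      1 [([blank], e), ([], ?n), (rev ?z0, []), ([], []), ([], []), (2 # ?n, [])]"
    by (rule runs_eq [OF runs_put]) auto
  \<comment> \<open>The two blocks of each equation, in the form that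
    \<open>runs_collect_words\<close> expects.\<close>
  define bs where "bs = concat (map (\<lambda>(u, v). [(encode_word u, 3 :: nat), (encode_word v, 4)]) E)"
  have bs: "concat (map (\<lambda>(w, c). w @ [c]) bs) = e"
    "concat (map fst bs) = encode_word (concat (map (\<lambda>(u, v). u @ v) E))"
    unfolding bs_def e_def by (induction E) auto
  have z: "rev (concat (map fst bs)) @ rev ?z0 = rev z"
    by (simp add: bs(2) z_def letters_of_system_def)
  have blocks: "set w \<subseteq> {1, 2} \<and> c \<in> {3, 4}" if "(w, c) \<in> set bs" for w c
    using that set_encode_word unfolding bs_def by fastforce
  have 4: "runs collect_words [([], e), ([], ?n), (rev ?z0, []), ([], []), ([], []), (2 # ?n, [])]
      (4 * length e + 1)
      [(rev e, []), ([], ?n), (rev z, []), ([], []), ([], []), (2 # ?n, [])]"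
    using runs_collect_words [of bs "[]" "([], ?n)" "rev ?z0", OF blocks]
    by (simp only: bs(1) z append_Nil2)
  have e: "blank \<notin> set e" and z': "blank \<notin> set z"
    unfolding e_def z_def by (rule blank_notin_encode_equations blank_notin_encode_word)+
  have 5: "runs (rewind 0) [(rev e, []), ([], ?n), (rev z, []), ([], []), ([], []), (2 # ?n, [])]
      (3 * length e + 3) [([], e), ([], ?n), (rev z, []), ([], []), ([], []), (2 # ?n, [])]"
    by (rule runs_eq [OF runs_rewind [where xs = e and r = "[]"]]) (use e in auto)
  have 6: "runs (rewind 2) [([], e), ([], ?n), (rev z, []), ([], []), ([], []), (2 # ?n, [])]
      (3 * length z + 3) [([], e), ([], ?n), ([], z), ([], []), ([], []), (2 # ?n, [])]"
    by (rule runs_eq [OF runs_rewind [where xs = z and r = "[]"]]) (use z' in auto)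
  have 7: "runs (append_tape 2 3) [([], e), ([], ?n), ([], z), ([], []), ([], []), (2 # ?n, [])]
      (7 * length z + 4) [([], e), ([], ?n), ([], z), (rev z, []), ([], []), (2 # ?n, [])]"
    by (rule runs_eq [OF runs_append_tape]) (use z' in auto)
  have 8: "runs (rewind 3) [([], e), ([], ?n), ([], z), (rev z, []), ([], []), (2 # ?n, [])]
      (3 * length z + 3) [([], e), ([], ?n), ([], z), ([], z), ([], []), (2 # ?n, [])]"
    by (rule runs_eq [OF runs_rewind [where xs = z and r = "[]"]]) (use z' in auto)
  \<comment> \<open>With its last symbol erased, the leading number is indistinguishable from the
    blank part of tape 0, which now begins with the equations.\<close>
  have "list_all2 (\<sim>)
      [([blank], e), ([], ?n), (rev ?z0, []), ([], []), ([], []), (2 # ?n, [])]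
      [([], e), ([], ?n), (rev ?z0, []), ([], []), ([], []), (2 # ?n, [])]"
    using same_tape_pad [of "[]" 1 e 0] by simp
  note 3 = runs_weaken [OF 3 order_refl this]
  show ?thesis
    unfolding letters_prog_def
    by (rule runs_time [OF runs_Seq [OF 1 runs_Seq [OF 2 runs_Seq [OF 3 runs_Seq [OF 4
          runs_Seq [OF 5 runs_Seq [OF 6 runs_Seq [OF 7 8]]]]]]]]) simp
qed

lemma encode_word_marker:
  "encode_word (marker z) = encode_word z @ encode_word z @
    concat (map (\<lambda>k. encode_word [k] @ encode_word z) z)"
  by (simp add: marker_def encode_word_concat comp_def)

lemma runs_marker_prog:
  fixes ks defines "z \<equiv> encode_word ks" and "g \<equiv> encode_word (marker ks)"
  shows "runs marker_prog [d, d', ([], z), ([], z), ([], []), d'']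
    (length z * (7 * length z + 9) + 14 * length z + 3 * length g + 12)
    [d, d', ([], z), (rev z, []), ([], g), d'']"
proof -
  have z: "blank \<notin> set z" and g: "blank \<notin> set g"
    unfolding z_def g_def by (rule blank_notin_encode_word)+
  have g_eq: "g = z @ z @ concat (map (\<lambda>k. encode_word [k] @ z) ks)"
    unfolding g_def z_def by (rule encode_word_marker)
  have 1: "runs (append_tape 2 4) [d, d', ([], z), ([], z), ([], []), d''] (7 * length z + 4)
      [d, d', ([], z), ([], z), (rev z, []), d'']"
    by (rule runs_eq [OF runs_append_tape]) (use z in auto)
  have 2: "runs (append_tape 2 4) [d, d', ([], z), ([], z), (rev z, []), d''] (7 * length z + 4)
      [d, d', ([], z), ([], z), (rev z @ rev z, []), d'']"
    by (rule runs_eq [OF runs_append_tape]) (use z in auto)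
  have 3: "runs spread_letters [d, d', ([], z), ([], z), (rev z @ rev z, []), d'']
      (length z * (7 * length z + 9) + 1) [d, d', ([], z), (rev z, []), (rev g, []), d'']"
    using runs_spread_letters [OF z, of d d' "[]" ks "rev z @ rev z" d'', folded z_def]
    by (simp only: g_eq rev_append append_assoc append_Nil2)
  have 4: "runs (rewind 4) [d, d', ([], z), (rev z, []), (rev g, []), d''] (3 * length g + 3)
      [d, d', ([], z), (rev z, []), ([], g), d'']"
    by (rule runs_eq [OF runs_rewind [where xs = g and r = "[]"]]) (use g in auto)
  show ?thesis
    unfolding marker_prog_def
    by (rule runs_time [OF runs_Seq [OF 1 runs_Seq [OF 2 runs_Seq [OF 3 4]]]]) simp
qed

lemma runs_side_prog:
  fixes E ks defines "e \<equiv> concat (map encode_equation E)" and "g \<equiv> encode_word ks"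
  defines "T \<equiv> length e * (7 * length g + 13) + 7 * length g + 3 * length e + 8"
  shows "runs (side_prog left_sides) [([], e), d, d', d'', ([], g), (ol, [])] T
      [([], e), d, d', d'', ([], g), (rev (encode_word (side ks (map fst E))) @ ol, [])]" (is ?left)
    and "runs (side_prog right_sides) [([], e), d, d', d'', ([], g), (ol, [])] T
      [([], e), d, d', d'', ([], g), (rev (encode_word (side ks (map snd E))) @ ol, [])]" (is ?right)
proof -
  have e: "blank \<notin> set e" and g: "blank \<notin> set g"
    unfolding e_def g_def by (rule blank_notin_encode_equations blank_notin_encode_word)+
  let ?S = "\<lambda>i o'. [i, d, d', d'', ([], g), (o', [])]"
  have side: "rev (concat (map (\<lambda>u. encode_word u @ g) us)) @ rev g @ ol =
      rev (encode_word (side ks us)) @ ol" for us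
    by (simp add: side_def g_def encode_word_concat comp_def)
  have 1: "runs (append_tape 4 5) (?S ([], e) ol) (7 * length g + 4) (?S ([], e) (rev g @ ol))"
    by (rule runs_eq [OF runs_append_tape]) (use g in auto)
  have 3: "runs (rewind 0) (?S (rev e, []) o') (3 * length e + 3) (?S ([], e) o')" for o'
    by (rule runs_eq [OF runs_rewind [where xs = e and r = "[]"]]) (use e in auto)
  have "runs left_sides (?S ([], e) (rev g @ ol)) (length e * (7 * length g + 13) + 1)
      (?S (rev e, []) (rev (encode_word (side ks (map fst E))) @ ol))"
    using runs_left_sides [OF g, of "[]" E d d' d'' "rev g @ ol", folded e_def]
    by (simp only: side append_Nil2)
  from runs_Seq [OF 1 runs_Seq [OF this 3]] show ?left
    unfolding side_prog_def T_def by (rule runs_time) simp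
  have "runs right_sides (?S ([], e) (rev g @ ol)) (length e * (7 * length g + 13) + 1)
      (?S (rev e, []) (rev (encode_word (side ks (map snd E))) @ ol))"
    using runs_right_sides [OF g, of "[]" E d d' d'' "rev g @ ol", folded e_def]
    by (simp only: side append_Nil2)
  from runs_Seq [OF 1 runs_Seq [OF this 3]] show ?right
    unfolding side_prog_def T_def by (rule runs_time) simp
qed

section \<open>The polynomial time bound\<close>

definition word_time :: "nat \<Rightarrow> nat \<Rightarrow> nat \<Rightarrow> nat \<Rightarrow> nat" where
  "word_time n e z g =
     (n * (7 * n + 11) + 7 * e + 13 * z + 17) + (z * (7 * z + 9) + 14 * z + 3 * g + 12) +
     5 * (e * (7 * g + 13) + 7 * g + 3 * e + 8) + (3 * (n + 1 + 5 * ((e + 1) * g + e)) + 3)"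

text \<open>The summands of \<open>word_time\<close> stand for \<open>letters_prog\<close>,
  \<open>marker_prog\<close>, the five passes over the equations and the final rewind. Monotonicity
  allows the lengths to be replaced by bounds in terms of the input length.\<close>

lemma word_time_mono:
  "n \<le> n' \<Longrightarrow> e \<le> e' \<Longrightarrow> z \<le> z' \<Longrightarrow> g \<le> g' \<Longrightarrow> word_time n e z g \<le> word_time n' e' z' g'"
  unfolding word_time_def by (intro add_mono mult_mono order_refl) auto

lemma runs_word_prog:
  fixes \<Gamma> n E defines "e \<equiv> concat (map encode_equation E)"
    and "ks \<equiv> letters_of_system n E"
    and "y \<equiv> encode (NonPrim \<Gamma>) (word_of_system (n, E))"
  shows "\<exists>B. runs word_prog (([], replicate n 1 @ 2 # e) # replicate 5 ([], []))
      (word_time n (length e) (length (encode_word ks)) (length (encode_word (marker ks)))) B \<and>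
    B \<noteq> [] \<and> last B = ([], y) \<and> blank \<notin> set y"
proof -
  let ?n = "replicate n (1 :: nat)" and ?z = "encode_word ks" and ?g = "encode_word (marker ks)"
  let ?a = "encode_word (side (marker ks) (map fst E))"
    and ?b = "encode_word (side (marker ks) (map snd E))"
  have y: "y = ?n @ 2 # ?a @ ?a @ ?a @ ?a @ ?b"
    unfolding y_def ks_def
    by (simp add: word_of_system_def Let_def NonPrim_def encode_nat_def)
  have blank: "blank \<notin> set y"
    unfolding y by simp
  \<comment> \<open>A side contains one marker more than there are equations, and there are at most
    \<open>length e\<close> equations.\<close>
  have len: "length ?a \<le> (length e + 1) * length ?g + length e"
    "length ?b \<le> (length e + 1) * length ?g + length e"
    unfolding e_def by (induction E) (auto simp: side_def algebra_simps)
  have "length y = n + 1 + (4 * length ?a + length ?b)"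
    unfolding y by simp
  also have "\<dots> \<le> n + 1 + 5 * ((length e + 1) * length ?g + length e)"
    using add_mono [OF mult_le_mono2 [OF len(1), of 4] len(2)] by simp
  finally have y_len: "length y \<le> n + 1 + 5 * ((length e + 1) * length ?g + length e)" .
  let ?S = "\<lambda>o'. [([], e), ([], ?n), ([], ?z), (rev ?z, []), ([], ?g), o']"
  have 1: "runs letters_prog (([], ?n @ 2 # e) # replicate 5 ([], []))
      (n * (7 * n + 11) + 7 * length e + 13 * length ?z + 17)
      [([], e), ([], ?n), ([], ?z), ([], ?z), ([], []), (2 # ?n, [])]"
    unfolding e_def ks_def by (rule runs_letters_prog)
  note 2 = runs_marker_prog [of "([], e)" "([], ?n)" ks "(2 # ?n, [])"]
  note l = runs_side_prog(1) [of E "([], ?n)" "([], ?z)" "(rev ?z, [])" "marker ks", folded e_def]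
  note r = runs_side_prog(2) [of E "([], ?n)" "([], ?z)" "(rev ?z, [])" "marker ks", folded e_def]
  note 3 = runs_Seq [OF l [of "2 # ?n"] runs_Seq [OF l runs_Seq [OF l runs_Seq [OF l r]]]]
  have rev_y: "rev ?b @ rev ?a @ rev ?a @ rev ?a @ rev ?a @ 2 # ?n = rev y"
    unfolding y by simp
  have 4: "runs (rewind 5) (?S (rev y, [])) (3 * length y + 3) (?S ([], y))"
    by (rule runs_eq [OF runs_rewind [where xs = y and r = "[]"]]) (use blank in auto)
  note all = runs_Seq [OF 1 runs_Seq [OF 2 runs_Seq [OF 3 [unfolded rev_y] 4]]]
  have "runs word_prog (([], ?n @ 2 # e) # replicate 5 ([], []))
      (word_time n (length e) (length ?z) (length ?g)) (?S ([], y))"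
    unfolding word_prog_def sides_prog_def
    by (rule runs_time [OF all]) (use y_len in \<open>simp add: word_time_def\<close>)
  then show ?thesis
    using blank by (intro exI [of _ "?S ([], y)"]) simp
qed

lemma length_encode_upt: "length (encode_word [0..<n]) \<le> n * n"
  by (induction n) auto

lemma length_encode_letters_of_system:
  "length (encode_word (letters_of_system n E)) \<le>
    n * n + length (concat (map encode_equation E))"
proof -
  have "length (encode_word (concat (map (\<lambda>(u, v). u @ v) E))) \<le>
      length (concat (map encode_equation E))"
    by (induction E) auto
  then show ?thesis
    using length_encode_upt [of n] by (simp add: letters_of_system_def)
qed

text \<open>The number of blocks is the number of letters, which is at most the encoded
  length.\<close>

lemma length_encode_marker:
  "length (encode_word (marker ks)) \<le>
    3 * length (encode_word ks) + length (encode_word ks) * length (encode_word ks)"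
proof -
  have "length (concat (map (\<lambda>k. encode_word [k] @ z) ks)) \<le>
      length (encode_word ks) + length (encode_word ks) * length z" for z
    by (induction ks) (auto simp: algebra_simps)
  then show ?thesis
    unfolding encode_word_marker by (simp add: add.assoc)
qed

lemma polytime_word_of_system:
  "polytime_computable (EqSatCF \<Gamma>) (NonPrim \<Gamma>) word_of_system"
proof -
  let ?M = "machine {..4} 6 word_prog"
  have "uses {..4} 6 word_prog"
    by (auto simp: word_prog_def letters_prog_def marker_prog_def sides_prog_def side_prog_def
        list_letters_def collect_words_def spread_letters_def left_sides_def right_sides_def
        intro!: lists_nth)
  then have M: "turing_machine ?M"
    by (rule turing_machine_machine) auto
  \<comment> \<open>\<open>P\<close> is \<open>word_time\<close> written as a polynomial in the
    input length; \<open>?Z\<close> and \<open>?G\<close> bound the encoded lengths of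
    \<open>z\<close> and of the marker.\<close>
  let ?X = "[:0, 1:] :: nat poly"
  let ?Z = "?X * ?X + ?X"
  let ?G = "[:3:] * ?Z + ?Z * ?Z"
  define P where "P =
     (?X * ([:7:] * ?X + [:11:]) + [:7:] * ?X + [:13:] * ?Z + [:17:]) +
     (?Z * ([:7:] * ?Z + [:9:]) + [:14:] * ?Z + [:3:] * ?G + [:12:]) +
     [:5:] * (?X * ([:7:] * ?G + [:13:]) + [:7:] * ?G + [:3:] * ?X + [:8:]) +
     ([:3:] * (?X + [:1:] + [:5:] * ((?X + [:1:]) * ?G + ?X)) + [:3:])"
  have P: "poly P L = word_time L L (L * L + L)
      (3 * (L * L + L) + (L * L + L) * (L * L + L))" for L
    unfolding P_def word_time_def by (simp only: poly_add poly_mult poly_pCons poly_0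
        mult_zero_right mult_1_right add_0_right add_0 mult_1)
  have "outputs_within ?M (poly P (length x)) x (encode (NonPrim \<Gamma>) (word_of_system I))"
    if x: "x = encode (EqSatCF \<Gamma>) I" for I x
  proof -
    obtain n E where I: "I = (n, E)"
      by fastforce
    let ?e = "concat (map encode_equation E)" and ?ks = "letters_of_system n E"
    let ?z = "encode_word ?ks" and ?g = "encode_word (marker ?ks)"
    define L where "L = length x"
    have x: "x = replicate n 1 @ 2 # ?e"
      unfolding x I by (rule encode_EqSatCF)
    then have L: "n \<le> L" "length ?e \<le> L"
      by (simp_all add: L_def)
    have z: "length ?z \<le> L * L + L"
      by (rule order_trans [OF length_encode_letters_of_system]) (intro add_mono mult_mono L; simp)
    have g: "length ?g \<le> 3 * (L * L + L) + (L * L + L) * (L * L + L)"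
      by (rule order_trans [OF length_encode_marker]) (intro add_mono mult_mono z order_refl; simp)
    have time: "word_time n (length ?e) (length ?z) (length ?g) \<le> poly P (length x)"
      unfolding P L_def [symmetric] by (intro word_time_mono L z g)
    obtain B where B: "runs word_prog (([], x) # replicate (6 - 1) ([], []))
        (word_time n (length ?e) (length ?z) (length ?g)) B"
      "B \<noteq> []" "last B = ([], encode (NonPrim \<Gamma>) (word_of_system I))"
      "blank \<notin> set (encode (NonPrim \<Gamma>) (word_of_system I))"
      using runs_word_prog [of n E \<Gamma>] unfolding x I by auto
    show ?thesis
      by (rule outputs_within_machine [OF B time])
  qed
  moreover have "encode (EqSatCF \<Gamma>) I \<in> lists (symbols ?M - {blank})" for I
  proof -
    obtain n E where I: "I = (n, E)"
      by fastforce
    have "set (encode (EqSatCF \<Gamma>) I) \<subseteq> {..4} - {blank}"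
      using set_encode_equations [of E] unfolding I encode_EqSatCF
      by (auto simp del: set_concat)
    then show ?thesis
      by (auto simp: machine_def)
  qed
  ultimately show ?thesis
    unfolding polytime_computable_def using M by blast
qed

section \<open>Combinatorics on words\<close>

lemma prefix_same_length: "u @ x = v @ y \<Longrightarrow> length u = length v \<Longrightarrow> u = v"
  by simp

lemma prefix_shorter:
  assumes "u @ x = v @ y" and "length u \<le> length v"
  obtains t where "v = u @ t"
  using assms by (auto simp: append_eq_append_conv2)

lemma word_power_simps [simp]:
  "word_power r 0 = []" "word_power r (Suc n) = r @ word_power r n"
  "word_power [] n = []"
  by (induction n) (simp_all add: word_power_def)

lemma word_power_add: "word_power r (m + n) = word_power r m @ word_power r n"
  by (induction m) auto

lemma word_power_mult: "word_power (word_power r m) n = word_power r (m * n)"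
  by (induction n) (auto simp: word_power_add)

lemma length_word_power [simp]: "length (word_power r n) = n * length r"
  by (induction n) auto

lemma set_word_power_subset: "set (word_power r n) \<subseteq> set r"
  by (induction n) auto

lemma word_power_comm: "word_power r i @ word_power r j = word_power r j @ word_power r i"
  by (metis add.commute word_power_add)

lemma word_power_lists: "r \<in> lists \<Gamma> \<Longrightarrow> word_power r k \<in> lists \<Gamma>"
  using set_word_power_subset [of r k] by (auto simp: in_lists_conv_set)

lemma comm_word_power:
  assumes "x @ s = s @ x" shows "x @ word_power s n = word_power s n @ x"
proof (induction n)
  case (Suc n)
  then show ?case
    using assms by (metis append.assoc word_power_simps(2))
qed simp

text \<open>Both products are the prefix of length \<open>length x + length y\<close> of a power of \<open>s\<close>.\<close>

lemma comm_trans: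
  assumes "x @ s = s @ x" and "y @ s = s @ y" and "s \<noteq> []"
  shows "x @ y = y @ x"
proof -
  let ?S = "word_power s (length x + length y)"
  have comm: "x @ ?S = ?S @ x" "y @ ?S = ?S @ y"
    using assms by (simp_all add: comm_word_power)
  then have "(x @ y) @ ?S = ?S @ x @ y" "(y @ x) @ ?S = ?S @ y @ x"
    by (metis append.assoc)+
  moreover have "length (x @ y) \<le> length ?S"
    using assms(3) by (cases s) auto
  ultimately have "x @ y = take (length (x @ y)) ?S" "y @ x = take (length (x @ y)) ?S"
    by (metis append_eq_conv_conj append_eq_append_conv_if,
        metis append_eq_conv_conj append_eq_append_conv_if add.commute length_append)
  then show ?thesis
    by (simp only:)
qed

text \<open>Let \<open>r\<close> be a shortest nonempty word commuting with \<open>s\<close>. A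
  nonempty \<open>x\<close> that commutes with \<open>s\<close> also commutes with \<open>r\<close>
  and is at least as long, so it begins with \<open>r\<close>; cancelling \<open>r\<close> leaves a
  shorter word that commutes with \<open>s\<close>.\<close>

lemma common_root:
  assumes "\<And>x. x \<in> X \<Longrightarrow> x @ s = s @ x" and "s \<noteq> []"
  obtains r where "\<And>x. x \<in> X \<Longrightarrow> \<exists>k. x = word_power r k" "r \<noteq> []"
proof -
  obtain r where r: "r \<noteq> []" "r @ s = s @ r"
    and min: "\<And>r'. r' \<noteq> [] \<Longrightarrow> r' @ s = s @ r' \<Longrightarrow> length r \<le> length r'"
    using ex_has_least_nat [of "\<lambda>r. r \<noteq> [] \<and> r @ s = s @ r" s length] assms(2) by auto
  have "\<exists>k. x = word_power r k" if "x @ s = s @ x" for x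
    using that
  proof (induction "length x" arbitrary: x rule: less_induct)
    case less
    show ?case
    proof (cases "x = []")
      case True
      then show ?thesis
        by (intro exI [of _ 0]) simp
    next
      case False
      have "x @ r = r @ x"
        using comm_trans [OF less.prems r(2) assms(2)] .
      moreover have "length r \<le> length x"
        using min False less.prems by blast
      ultimately obtain y where y: "x = r @ y"
        using prefix_shorter [of r x x r] by metis
      have "r @ s @ y = r @ y @ s"
        using less.prems r(2) unfolding y by (metis append.assoc)
      then have "y @ s = s @ y"
        by simp
      then obtain k where "y = word_power r k"
        using less.hyps [of y] y r(1) by auto
      then show ?thesis
        using y by (intro exI [of _ "Suc k"]) simp
    qed
  qed
  then show ?thesis
    using that r(1) assms(1) by blast
qed

text \<open>A weak form of the theorem of Fine and Wilf: \<open>a @ r\<close> and \<open>r @ a\<close> are both prefixes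
  of \<open>a\<^sup>4 b\<close>.\<close>

lemma comm_of_imprimitive:
  assumes eq: "a @ a @ a @ a @ b = word_power r m" and "m \<ge> 2"
    and len: "length b \<le> 2 * length a"
  shows "a @ b = b @ a"
proof (cases "a = []")
  case False
  obtain k where m: "m = Suc (Suc k)"
    using assms(2) by (metis add_2_eq_Suc le_iff_add)
  let ?w = "a @ a @ a @ a @ b"
  have w: "?w = r @ word_power r (Suc k)"
    using eq m by simp
  have "length ?w = (k + 2) * length r"
    unfolding eq m by simp
  \<comment> \<open>As \<open>m \<ge> 2\<close>, \<open>r\<close> is at most half of the word, whose
    length is at most \<open>6 * length a\<close>. So \<open>r\<close> is a prefix of
    \<open>a @ a @ a\<close>, and the remaining factor \<open>a\<close> goes in front of it.\<close>
  then have half: "2 * length r \<le> length ?w"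
    by simp
  then have r: "length r \<le> length (a @ a @ a)"
    using len by simp
  obtain t where t: "a @ a @ a = r @ t"
    using w r prefix_shorter [of r "word_power r (Suc k)" "a @ a @ a" "a @ b"]
    by (metis append.assoc)
  have 1: "?w = (a @ r) @ t @ b"
    using t by (metis append.assoc)
  \<comment> \<open>Splitting \<open>r\<close> off at the end leaves at least half of the word,
    hence a power that begins with \<open>a\<close>. Putting \<open>r\<close> in front of it instead
    gives the prefix \<open>r @ a\<close>.\<close>
  have "?w = word_power r (Suc k) @ r"
    using w comm_word_power [of r r "Suc k"] by simp
  moreover have "length a \<le> length (word_power r (Suc k))"
  proof -
    have "length ?w = length r + length (word_power r (Suc k))"
      unfolding w by simp
    then show ?thesis
      using half by simp
  qed
  ultimately obtain t' where "word_power r (Suc k) = a @ t'"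
    using prefix_shorter [of a "a @ a @ a @ b" "word_power r (Suc k)" r] by metis
  then have 2: "?w = (r @ a) @ t'"
    using w by simp
  have "a @ r = r @ a"
    by (rule prefix_same_length [OF 1 [symmetric, THEN trans, OF 2]]) simp
  then have "a @ ?w = ?w @ a"
    unfolding eq by (rule comm_word_power)
  then show ?thesis
    by simp
qed simp

section \<open>Synchronization\<close>

text \<open>Since \<open>z\<close> begins with \<open>s\<close>, comparing prefixes of the first
  block and its shift gives \<open>s @ b = b @ s\<close>. Moving \<open>s\<close> across
  \<open>b\<close> and \<open>z\<close> and cancelling these reproduces the situation for the
  remaining blocks.\<close>

lemma sync_tail:
  assumes z: "z = s @ z'" and comm: "z @ s = s @ z"
    and pre: "s @ concat (map (\<lambda>a. a @ z) as) = concat (map (\<lambda>a. a @ z) as) @ t"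
    and a: "a \<in> set as"
  shows "a @ s = s @ a"
  using pre a
proof (induction as)
  case (Cons b as)
  let ?y = "concat (map (\<lambda>a. a @ z) as)"
  have eq: "s @ b @ z @ ?y = b @ z @ ?y @ t"
    using Cons.prems(1) by simp
  then have "(s @ b) @ z @ ?y = (b @ s) @ z' @ ?y @ t"
    using z by simp
  then have b: "b @ s = s @ b"
    by (metis prefix_same_length length_append add.commute)
  have "b @ z @ s @ ?y = b @ z @ ?y @ t"
    using eq b comm by (metis append.assoc)
  then have "s @ ?y = ?y @ t"
    by simp
  then show ?case
    using Cons b by auto
qed simp

text \<open>A marker that is shifted onto itself by a short word \<open>s\<close> has the period \<open>s\<close>: first
  \<open>s\<close> commutes with \<open>z\<close>, and then with the letters one after the other.\<close>

lemma sync: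
  assumes pre: "s @ z @ z @ concat (map (\<lambda>a. a @ z) as) = (z @ z @ concat (map (\<lambda>a. a @ z) as)) @ t"
    and len: "length s \<le> length z" and a: "a \<in> set as"
  shows "a @ s = s @ a"
proof -
  let ?y = "concat (map (\<lambda>a. a @ z) as)"
  obtain z' where z: "z = s @ z'"
    using pre len prefix_shorter [of s "z @ z @ concat (map (\<lambda>a. a @ z) as)" z]
    by (metis append.assoc)
  \<comment> \<open>This uses the second leading copy of \<open>z\<close>: after cancelling
    \<open>s\<close>, the word \<open>z'\<close> is followed by that copy, which begins with
    \<open>s\<close>, so \<open>s @ z'\<close> meets \<open>z' @ s\<close>.\<close>
  have "s @ (s @ z') @ z @ ?y = (s @ z') @ (s @ z') @ ?y @ t"
    using pre z by simp
  then have "(s @ z') @ z @ ?y = (z' @ s) @ z' @ ?y @ t"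
    by simp
  then have "s @ z' = z' @ s"
    by (rule prefix_same_length) simp
  then have comm: "z @ s = s @ z"
    using z by simp
  then have "z @ z @ s @ ?y = z @ z @ ?y @ t"
    using pre by (metis append.assoc)
  then have "s @ ?y = ?y @ t"
    by simp
  from sync_tail [OF z comm this a] show ?thesis .
qed

text \<open>If the first factors had different lengths, the marker behind the shorter one would
  overlap the marker behind the longer one with a nonempty shift of length at most \<open>n\<close>.
  So they agree and can be cancelled.\<close>

lemma marked_factors_eq:
  assumes "concat (map (\<lambda>u. u @ g) us) = concat (map (\<lambda>u. u @ g) vs)"
    and "length us = length vs"
    and "\<And>u. u \<in> set us \<union> set vs \<Longrightarrow> length u \<le> n"
    and no_shift: "\<And>s t. s @ g = g @ t \<Longrightarrow> length s \<le> n \<Longrightarrow> s = []"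
  shows "us = vs"
  using assms(2,1,3)
proof (induction us vs rule: list_induct2)
  case (Cons u us v vs)
  let ?x = "concat (map (\<lambda>u. u @ g) us)" and ?y = "concat (map (\<lambda>u. u @ g) vs)"
  have eq: "u @ g @ ?x = v @ g @ ?y"
    using Cons.prems(1) by simp
  have shift: "s = []" if shifted: "g @ p = s @ g @ q" and "length s \<le> n" for s p q
  proof -
    obtain t where "s @ g = g @ t"
      by (rule prefix_shorter [of g p "s @ g" q]) (use shifted in auto)
    then show ?thesis
      using no_shift that(2) by blast
  qed
  have "u = v"
    using eq unfolding append_eq_append_conv2 [of u]
  proof (elim exE disjE conjE)
    fix s assume "u = v @ s" "s @ g @ ?x = g @ ?y"
    then show ?thesis
      using shift [of ?y s ?x] Cons.prems(2) [of u] by auto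
  next
    fix s assume "u @ s = v" "g @ ?x = s @ g @ ?y"
    then show ?thesis
      using shift [of ?x s ?y] Cons.prems(2) [of v] by auto
  qed
  then show ?case
    using eq Cons by auto
qed simp

lemma length_side:
  "length (side g us) = (Suc (length us)) * length g + sum_list (map length us)"
  by (induction us) (auto simp: side_def)

lemma sides_eq:
  assumes eq: "side g us @ side g us @ side g us @ side g us @ side g vs = word_power r m"
    and m: "m \<ge> 2" and len: "length us = length vs"
    and us: "sum_list (map length us) \<le> n" and vs: "sum_list (map length vs) \<le> n"
    and n: "n \<le> length g"
    and no_shift: "\<And>s t. s @ g = g @ t \<Longrightarrow> length s \<le> n \<Longrightarrow> s = []"
  shows "us = vs"
proof -
  \<comment> \<open>\<open>n \<le> length g\<close> keeps the second side within twice the length of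
    the first.\<close>
  have comm: "side g us @ side g vs = side g vs @ side g us"
    using us vs n len by (intro comm_of_imprimitive [OF eq m]) (simp add: length_side)
  \<comment> \<open>The longer of two commuting sides is the shorter one extended by
    \<open>p\<close> at the end and also at the front. Both sides begin with \<open>g\<close>, so
    \<open>p\<close> shifts the marker onto itself. As both contain equally many markers,
    \<open>p\<close> has length at most \<open>n\<close> and is therefore empty.\<close>
  have *: "side g us = side g vs"
    if c: "side g us @ side g vs = side g vs @ side g us" and l: "length us = length vs"
      and v: "sum_list (map length vs) \<le> n"
      and le: "length (side g us) \<le> length (side g vs)" for us vs
  proof -
    obtain p where p: "side g vs = side g us @ p"
      using prefix_shorter [OF c le] .
    have p': "side g vs = p @ side g us"
      using c p by simp
    have "length (side g vs) = length (side g us) + length p"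
      using p by simp
    then have "length p \<le> n"
      using l v by (simp add: length_side)
    moreover obtain x y where x: "side g us = g @ x" and y: "side g vs = g @ y"
      by (simp add: side_def)
    from p' have "g @ y = (p @ g) @ x"
      using x y by simp
    then obtain t where "p @ g = g @ t"
      by (rule prefix_shorter) auto
    ultimately show ?thesis
      using no_shift p by auto
  qed
  have "side g us = side g vs"
    using *[of us vs] *[of vs us] comm len us vs by (metis linorder_le_cases)
  then have "concat (map (\<lambda>u. u @ g) us) = concat (map (\<lambda>u. u @ g) vs)"
    by (simp add: side_def)
  moreover have "length u \<le> n" if "u \<in> set us \<union> set vs" for u
    using that us vs member_le_sum_list [of "length u" "map length us"]
      member_le_sum_list [of "length u" "map length vs"] by auto
  ultimately show ?thesis
    using len no_shift by (intro marked_factors_eq)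
qed

section \<open>Morphisms\<close>

lemma morphism_Nil:
  assumes "morphism \<Sigma> \<Gamma> h" shows "h [] = []"
proof -
  have "h ([] @ []) = h [] @ h []"
    using assms unfolding morphism_def by blast
  then show ?thesis
    by simp
qed

lemma morphism_append:
  "morphism \<Sigma> \<Gamma> h \<Longrightarrow> x \<in> lists \<Sigma> \<Longrightarrow> y \<in> lists \<Sigma> \<Longrightarrow> h (x @ y) = h x @ h y"
  by (simp add: morphism_def)

lemma morphism_Cons:
  "morphism \<Sigma> \<Gamma> h \<Longrightarrow> a \<in> \<Sigma> \<Longrightarrow> x \<in> lists \<Sigma> \<Longrightarrow> h (a # x) = h [a] @ h x"
  using morphism_append [of \<Sigma> \<Gamma> h "[a]" x] by simp

lemma morphism_lists: "morphism \<Sigma> \<Gamma> h \<Longrightarrow> x \<in> lists \<Sigma> \<Longrightarrow> h x \<in> lists \<Gamma>"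
  by (simp add: morphism_def)

lemma morphism_letters:
  assumes "morphism \<Sigma> \<Gamma> h" and "x \<in> lists \<Sigma>"
  shows "h x = concat (map (\<lambda>a. h [a]) x)"
  using assms(2)
proof induction
  case (Cons a x)
  then show ?case
    using morphism_Cons [OF assms(1), of a x] by simp
qed (simp add: morphism_Nil [OF assms(1)])

lemma morphism_concat_map:
  assumes "\<And>a. a \<in> \<Sigma> \<Longrightarrow> \<phi> a \<in> lists \<Gamma>"
  shows "morphism \<Sigma> \<Gamma> (\<lambda>x. concat (map \<phi> x))"
  using assms by (auto simp: morphism_def in_lists_conv_set)

text \<open>A morphism that erases every letter is periodic with the empty root.\<close>

lemma nonperiodic_nonempty_letter:
  assumes "\<not> periodic \<Sigma> \<Gamma> h" obtains a where "a \<in> \<Sigma>" "h [a] \<noteq> []"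
proof -
  have "\<exists>a \<in> \<Sigma>. h [a] \<noteq> []"
  proof (rule ccontr)
    assume "\<not> ?thesis"
    then have "\<forall>a \<in> \<Sigma>. \<exists>k. h [a] = word_power [] k"
      by simp
    then show False
      using assms unfolding periodic_def by blast
  qed
  then show ?thesis
    using that by blast
qed

lemma periodicI_comm:
  assumes h: "morphism \<Sigma> \<Gamma> h" and comm: "\<And>a. a \<in> \<Sigma> \<Longrightarrow> h [a] @ s = s @ h [a]" and "s \<noteq> []"
  shows "periodic \<Sigma> \<Gamma> h"
proof (rule ccontr)
  assume non: "\<not> ?thesis"
  then obtain a where a: "a \<in> \<Sigma>" "h [a] \<noteq> []"
    by (rule nonperiodic_nonempty_letter)
  obtain r where r: "\<And>x. x \<in> (\<lambda>a. h [a]) ` \<Sigma> \<Longrightarrow> \<exists>k. x = word_power r k"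
    by (rule common_root [of "(\<lambda>a. h [a]) ` \<Sigma>" s]) (use comm \<open>s \<noteq> []\<close> in auto)
  obtain k where k: "h [a] = word_power r k"
    using r a(1) by blast
  \<comment> \<open>The word \<open>s\<close> need not be over \<Gamma>, so that \<open>r\<close> is
    over \<Gamma> has to be read off from a nonempty image of a letter.\<close>
  with a(2) have "set r \<subseteq> set (h [a])"
    by (cases k) auto
  then have "r \<in> lists \<Gamma>"
    using morphism_lists [OF h, of "[a]"] a(1) by (auto simp: in_lists_conv_set)
  then show False
    using r non unfolding periodic_def by blast
qed

section \<open>Correctness of the reductions\<close>

text \<open>The missing letter goes to \<open>b\<close> and every other letter to
  \<open>a a\<close>: this is nonperiodic, while the image of \<open>w\<close> is an even power of
  \<open>a\<close>. The doubled \<open>a\<close> also covers words of length one.\<close>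

lemma NonPrim_missing_letter:
  assumes ab: "a \<in> \<Gamma>" "b \<in> \<Gamma>" "a \<noteq> b"
    and w: "w \<in> lists {..<n}" "w \<noteq> []" and c: "c < n" "c \<notin> set w"
  shows "answer_yes (NonPrim \<Gamma>) (n, w)"
proof -
  define \<phi> where "\<phi> x = (if x = c then [b] else [a, a])" for x :: nat
  define h where "h x = concat (map \<phi> x)" for x
  have mor: "morphism {..<n} \<Gamma> h"
    unfolding h_def by (rule morphism_concat_map) (use ab in \<open>auto simp: \<phi>_def\<close>)
  have "\<not> periodic {..<n} \<Gamma> h"
  proof
    assume "periodic {..<n} \<Gamma> h"
    then obtain r where r: "\<And>x. x < n \<Longrightarrow> \<exists>k. h [x] = word_power r k"
      unfolding periodic_def by blast
    have d: "hd w < n" "hd w \<noteq> c"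
      using w c(2) hd_in_set [of w] by (auto simp: in_lists_conv_set)
    have "h [c] @ h [hd w] = h [hd w] @ h [c]"
      using r [OF c(1)] r [OF d(1)] word_power_comm by metis
    then show False
      using d ab(3) by (simp add: h_def \<phi>_def)
  qed
  \<comment> \<open>The root is \<open>a\<close> to the power \<open>length w\<close>, with one
    \<open>a\<close> split off so that it is visibly nonempty.\<close>
  moreover have "h w = word_power ([a] @ word_power [a] (length w - 1)) 2"
  proof -
    have "h w = word_power [a, a] (length w)"
      unfolding h_def using c(2) by (induction w) (auto simp: \<phi>_def)
    also have "\<dots> = word_power (word_power [a] 2) (length w)"
      by (simp add: numeral_2_eq_2)
    also have "\<dots> = word_power (word_power [a] (Suc (length w - 1))) 2"
      using w(2) by (simp only: word_power_mult) (simp add: mult.commute)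
    finally show ?thesis
      by simp
  qed
  moreover have "[a] @ word_power [a] (length w - 1) \<in> lists \<Gamma>"
    using ab(1) word_power_lists [of "[a]" \<Gamma>] by simp
  ultimately show ?thesis
    unfolding NonPrim_def nonperiodic_morphism_def using mor
    by (auto intro!: exI [of _ "2::nat"] exI [of _ h]
        exI [of _ "[a] @ word_power [a] (length w - 1)"])
qed

lemma system_of_word_correct:
  assumes ab: "a \<in> \<Gamma>" "b \<in> \<Gamma>" "a \<noteq> b" and w: "w \<in> lists {..<n}" "w \<noteq> []"
  shows "answer_yes (NonPrim \<Gamma>) (n, w) \<longleftrightarrow> answer_yes (EqSatCF \<Gamma>) (system_of_word (n, w))"
proof
  assume "answer_yes (NonPrim \<Gamma>) (n, w)"
  then obtain m h r where m: "m \<ge> 2" and h: "morphism {..<n} \<Gamma> h" "\<not> periodic {..<n} \<Gamma> h"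
    and r: "r \<in> lists \<Gamma>" and hw: "h w = word_power r m"
    by (auto simp: NonPrim_def nonperiodic_morphism_def)
  obtain i j where ij: "m = 3 * i + 2 * j"
  proof (cases "even m")
    case True
    then show ?thesis
      using that [of 0 "m div 2"] by simp
  next
    case False
    then have "m = 3 * 1 + 2 * ((m - 3) div 2)"
      using m by (auto elim!: oddE)
    then show ?thesis
      by (rule that)
  qed
  define \<phi> where "\<phi> x = (if x = 0 then word_power r i else if x = 1 then word_power r j
    else h [x - 2])" for x
  define g where "g x = concat (map \<phi> x)" for x
  have "\<phi> x \<in> lists \<Gamma>" if "x < n + 2" for x
    using that r morphism_lists [OF h(1), of "[x - 2]"]
    by (auto simp: \<phi>_def word_power_lists)
  then have mor: "morphism {..<n + 2} \<Gamma> g"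
    unfolding g_def by (intro morphism_concat_map) auto
  have "\<not> periodic {..<n + 2} \<Gamma> g"
  proof
    assume "periodic {..<n + 2} \<Gamma> g"
    then obtain q where q: "q \<in> lists \<Gamma>" "\<And>x. x < n + 2 \<Longrightarrow> \<exists>k. g [x] = word_power q k"
      unfolding periodic_def by blast
    have "\<exists>k. h [x] = word_power q k" if "x < n" for x
      using q(2) [of "x + 2"] that by (simp add: g_def \<phi>_def)
    then show False
      using h(2) q(1) unfolding periodic_def by blast
  qed
  moreover have "g (map (\<lambda>k. k + 2) w) = g [0, 0, 0, 1, 1]"
  proof -
    have "g (map (\<lambda>k. k + 2) w) = h w"
      unfolding morphism_letters [OF h(1) w(1)] g_def by (induction w) (auto simp: \<phi>_def)
    also have "\<dots> = g [0, 0, 0, 1, 1]"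
      unfolding hw ij by (simp add: g_def \<phi>_def word_power_add mult_2 eval_nat_numeral)
    finally show ?thesis .
  qed
  moreover have "g [0, 1] = g [1, 0]"
    by (simp add: g_def \<phi>_def word_power_comm)
  ultimately show "answer_yes (EqSatCF \<Gamma>) (system_of_word (n, w))"
    using mor
    by (auto simp: EqSatCF_def system_of_word_def nonperiodic_morphism_def solves_def)
next
  assume "answer_yes (EqSatCF \<Gamma>) (system_of_word (n, w))"
  then obtain g where g: "morphism {..<n + 2} \<Gamma> g" "\<not> periodic {..<n + 2} \<Gamma> g"
    and eqs: "g (map (\<lambda>k. k + 2) w) = g [0, 0, 0, 1, 1]" "g [0, 1] = g [1, 0]"
    by (auto simp: EqSatCF_def system_of_word_def nonperiodic_morphism_def solves_def)
  show "answer_yes (NonPrim \<Gamma>) (n, w)"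
  proof (cases "\<exists>c < n. c \<notin> set w")
    case True
    then show ?thesis
      using NonPrim_missing_letter [OF ab w] by blast
  next
    case False
    define h where "h x = concat (map (\<lambda>k. g [k + 2]) x)" for x
    have mor: "morphism {..<n} \<Gamma> h"
      unfolding h_def using morphism_lists [OF g(1)] by (intro morphism_concat_map) auto
    have "map (\<lambda>k. k + 2) w \<in> lists {..<n + 2}"
      using w(1) by (auto simp: in_lists_conv_set)
    from morphism_letters [OF g(1) this] have gw: "g (map (\<lambda>k. k + 2) w) = h w"
      by (simp add: h_def comp_def)
    have st: "g [0] @ g [1] = g [1] @ g [0]"
      using eqs(2) morphism_Cons [OF g(1), of 0 "[1]"] morphism_Cons [OF g(1), of 1 "[0]"] by simp
    then obtain i j r where r: "g [0] = word_power r i" "g [1] = word_power r j"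
      unfolding word_power_def using comm_append_are_replicate by metis
    have "h w = g [0, 0, 0, 1, 1]"
      using gw eqs(1) by simp
    also have "\<dots> = word_power r (i + i + i + j + j)"
      by (subst morphism_letters [OF g(1)]) (auto simp: r r(2) [unfolded One_nat_def] word_power_add)
    finally have hw: "h w = word_power r (i + i + i + j + j)" .
    \<comment> \<open>Here every letter occurs in \<open>w\<close>. If \<open>h w\<close> were
      empty, all letters would be erased, the images of \<open>s\<close> and \<open>t\<close> would
      be empty too, and \<open>g\<close> would be periodic.\<close>
    have ne: "h w \<noteq> []"
    proof
      assume "h w = []"
      then have "g [k + 2] = []" if "k < n" for k
        using False that by (auto simp: h_def)
      moreover have "g [0] = []" "g [1] = []"
        using hw \<open>h w = []\<close> r by (auto simp: word_power_add)
      moreover have "x = 0 \<or> x = 1 \<or> (\<exists>k < n. x = k + 2)" if "x < n + 2" for x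
        using that by presburger
      ultimately have "g [x] = []" if "x < n + 2" for x
        using that by metis
      then show False
        using nonperiodic_nonempty_letter [OF g(2)] by blast
    qed
    then have r_ne: "r \<noteq> []" and "i \<noteq> 0 \<or> j \<noteq> 0"
      unfolding hw by (auto intro: ccontr)
    then have m: "i + i + i + j + j \<ge> 2"
      by linarith
    have "set r \<subseteq> set (h w)"
      unfolding hw using m by (cases "i + i + i + j + j") auto
    then have r_lists: "r \<in> lists \<Gamma>"
      using morphism_lists [OF mor w(1)] by (auto simp: in_lists_conv_set)
    \<comment> \<open>If \<open>h\<close> had a root \<open>q\<close>, all its letter images would
      commute with \<open>h w\<close>. So would the images of \<open>s\<close> and \<open>t\<close>,
      which are powers of \<open>r\<close> like \<open>h w\<close>. As \<open>h w\<close> is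
      nonempty, \<open>g\<close> would be periodic.\<close>
    have "\<not> periodic {..<n} \<Gamma> h"
    proof
      assume "periodic {..<n} \<Gamma> h"
      then obtain q where q: "\<And>x. x < n \<Longrightarrow> \<exists>k. h [x] = word_power q k"
        unfolding periodic_def by blast
      have "\<exists>k. h w = word_power q k"
        using w(1)
      proof induction
        case Nil
        show ?case
          by (intro exI [of _ 0]) (simp add: h_def)
      next
        case (Cons x w)
        then show ?case
          using q [of x] morphism_Cons [OF mor, of x w] word_power_add [of q] by (metis lessThan_iff)
      qed
      then have "g [k + 2] @ h w = h w @ g [k + 2]" if "k < n" for k
        using q [OF that] word_power_comm [of q] by (auto simp: h_def)
      moreover have "g [0] @ h w = h w @ g [0]" "g [1] @ h w = h w @ g [1]"
        unfolding r hw by (rule word_power_comm)+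
      moreover have "x = 0 \<or> x = 1 \<or> (\<exists>k < n. x = k + 2)" if "x < n + 2" for x
        using that by presburger
      ultimately have "g [x] @ h w = h w @ g [x]" if "x < n + 2" for x
        using that by metis
      then show False
        using periodicI_comm [OF g(1) _ ne] g(2) by blast
    qed
    then show ?thesis
      using mor m r_lists r_ne hw unfolding NonPrim_def nonperiodic_morphism_def by auto
  qed
qed

lemma morphism_side:
  assumes h: "morphism \<Sigma> \<Gamma> h" and "g \<in> lists \<Sigma>" and "set us \<subseteq> lists \<Sigma>"
  shows "h (side g us) = side (h g) (map h us)"
proof -
  have "h (concat (map (\<lambda>u. u @ g) us)) = concat (map (\<lambda>u. u @ h g) (map h us)) \<and>
      concat (map (\<lambda>u. u @ g) us) \<in> lists \<Sigma>"
    using assms(3)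
    by (induction us) (use assms(2) in \<open>auto simp: morphism_Nil [OF h] morphism_append [OF h]\<close>)
  then show ?thesis
    using assms(2) by (auto simp: side_def morphism_append [OF h])
qed

text \<open>In general the image is not \<open>marker (h z)\<close>, because the single letters
  become words \<open>h [a]\<close>. This is why \<open>sync\<close> is stated for a list of
  words.\<close>

lemma morphism_marker:
  assumes h: "morphism \<Sigma> \<Gamma> h" and z: "z \<in> lists \<Sigma>"
  shows "h (marker z) = h z @ h z @ concat (map (\<lambda>a. a @ h z) (map (\<lambda>a. h [a]) z))"
proof -
  have "h (concat (map (\<lambda>a. a # z) y)) = concat (map (\<lambda>a. a @ h z) (map (\<lambda>a. h [a]) y)) \<and>
      concat (map (\<lambda>a. a # z) y) \<in> lists \<Sigma>" if "y \<in> lists \<Sigma>" for y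
    using that
  proof induction
    case (Cons a y)
    have *: "a # z \<in> lists \<Sigma>"
      using Cons z by simp
    have "h ((a # z) @ concat (map (\<lambda>a. a # z) y)) = (h [a] @ h z) @ h (concat (map (\<lambda>a. a # z) y))"
      using morphism_append [OF h *] morphism_Cons [OF h, of a z] Cons z
      by (auto simp: in_lists_conv_set)
    then show ?case
      using Cons z by simp
  qed (simp add: morphism_Nil [OF h])
  then show ?thesis
    using z by (auto simp: marker_def morphism_append [OF h])
qed

lemma marker_lists: "z \<in> lists \<Sigma> \<Longrightarrow> marker z \<in> lists \<Sigma>"
  by (auto simp: marker_def in_lists_conv_set)

lemma side_lists: "g \<in> lists \<Sigma> \<Longrightarrow> set us \<subseteq> lists \<Sigma> \<Longrightarrow> side g us \<in> lists \<Sigma>"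
  by (auto simp: side_def in_lists_conv_set)

lemma length_morphism_letters_of_system:
  assumes h: "morphism {..<n} \<Gamma> h" and E: "set E \<subseteq> lists {..<n} \<times> lists {..<n}"
  shows "sum_list (map length (map h (map fst E))) + sum_list (map length (map h (map snd E)))
    \<le> length (h (letters_of_system n E))"
proof -
  have "sum_list (map length (map h (map fst E))) + sum_list (map length (map h (map snd E))) =
      length (h (concat (map (\<lambda>(u, v). u @ v) E))) \<and>
      concat (map (\<lambda>(u, v). u @ v) E) \<in> lists {..<n}"
    using E
  proof (induction E)
    case (Cons e E)
    obtain u v where e: "e = (u, v)" "u \<in> lists {..<n}" "v \<in> lists {..<n}"
      using Cons.prems by auto
    let ?w = "concat (map (\<lambda>(u, v). u @ v) E)"
    have IH: "?w \<in> lists {..<n}"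
      "sum_list (map length (map h (map fst E))) + sum_list (map length (map h (map snd E))) =
        length (h ?w)"
      using Cons by auto
    then have "h (u @ v @ ?w) = h u @ h v @ h ?w" "u @ v @ ?w \<in> lists {..<n}"
      using e(2,3) by (simp_all add: morphism_append [OF h])
    then show ?case
      using IH(2) e(1) by simp
  qed (simp add: morphism_Nil [OF h])
  then show ?thesis
    using morphism_append [OF h, of "[0..<n]" "concat (map (\<lambda>(u, v). u @ v) E)"]
      in_listsI [of "[0..<n]" "{..<n}"]
    by (simp add: letters_of_system_def)
qed

lemma word_of_system_instance:
  assumes "n \<ge> 2" and "set E \<subseteq> lists {..<n} \<times> lists {..<n}"
  shows "word_of_system (n, E) \<in> instances (NonPrim \<Gamma>)"
    and "letters_of_system n E \<in> lists {..<n}"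
    and "{..<n} \<subseteq> set (letters_of_system n E)"
proof -
  show z: "letters_of_system n E \<in> lists {..<n}"
    using assms(2) by (fastforce simp: letters_of_system_def in_lists_conv_set)
  show sub: "{..<n} \<subseteq> set (letters_of_system n E)"
    by (auto simp: letters_of_system_def)
  have E': "set (map fst E) \<subseteq> lists {..<n}" "set (map snd E) \<subseteq> lists {..<n}"
    using assms(2) by fastforce+
  have "side (marker (letters_of_system n E)) (map fst E) \<in> lists {..<n}"
    "side (marker (letters_of_system n E)) (map snd E) \<in> lists {..<n}"
    by (rule side_lists [OF marker_lists [OF z]], rule E')+
  moreover have "letters_of_system n E \<noteq> []"
    using assms(1) by (simp add: letters_of_system_def)
  ultimately show "word_of_system (n, E) \<in> instances (NonPrim \<Gamma>)"
    using assms(1)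
    by (simp add: NonPrim_def word_of_system_def Let_def) (simp add: side_def marker_def)
qed

lemma word_of_system_correct:
  assumes n: "n \<ge> 2" and E: "set E \<subseteq> lists {..<n} \<times> lists {..<n}"
  shows "answer_yes (EqSatCF \<Gamma>) (n, E) \<longleftrightarrow> answer_yes (NonPrim \<Gamma>) (word_of_system (n, E))"
proof -
  define z where "z = letters_of_system n E"
  define g where "g = marker z"
  define a where "a = side g (map fst E)"
  define b where "b = side g (map snd E)"
  have z: "z \<in> lists {..<n}" "{..<n} \<subseteq> set z"
    unfolding z_def using word_of_system_instance [OF n E] by auto
  have g: "g \<in> lists {..<n}"
    unfolding g_def by (rule marker_lists [OF z(1)])
  have E': "set (map fst E) \<subseteq> lists {..<n}" "set (map snd E) \<subseteq> lists {..<n}"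
    using E by fastforce+
  have ab: "a \<in> lists {..<n}" "b \<in> lists {..<n}"
    unfolding a_def b_def by (rule side_lists [OF g], rule E')+
  have word: "word_of_system (n, E) = (n, a @ a @ a @ a @ b)"
    by (simp add: word_of_system_def Let_def a_def b_def g_def z_def)
  have hword: "h (a @ a @ a @ a @ b) = h a @ h a @ h a @ h a @ h b"
    if "morphism {..<n} \<Gamma> h" for h
    using ab that by (simp add: morphism_append)
  have hg: "h g = h z @ h z @ concat (map (\<lambda>a. a @ h z) (map (\<lambda>a. h [a]) z))"
    if "morphism {..<n} \<Gamma> h" for h
    unfolding g_def using morphism_marker [OF that z(1)] .
  have ha: "h a = side (h g) (map h (map fst E))" and hb: "h b = side (h g) (map h (map snd E))"
    if "morphism {..<n} \<Gamma> h" for h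
    unfolding a_def b_def by (rule morphism_side [OF that g], rule E')+
  show ?thesis
  proof
    assume "answer_yes (EqSatCF \<Gamma>) (n, E)"
    then obtain h where h: "morphism {..<n} \<Gamma> h" "\<not> periodic {..<n} \<Gamma> h"
      and sol: "\<And>u v. (u, v) \<in> set E \<Longrightarrow> h u = h v"
      by (auto simp: EqSatCF_def nonperiodic_morphism_def solves_def)
    have "map h (map fst E) = map h (map snd E)"
      using sol by auto
    then have "h a = h b"
      by (simp only: ha [OF h(1)] hb [OF h(1)])
    \<comment> \<open>Equal images of the two sides turn the word into a fifth power.\<close>
    then have "h (a @ a @ a @ a @ b) = word_power (h a) 5"
      using hword [OF h(1)] by (simp add: eval_nat_numeral)
    moreover have "h a \<noteq> []"
    proof
      assume "h a = []"
      then have "h z = []"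
        using ha [OF h(1)] hg [OF h(1)] by (simp add: side_def)
      then have "\<forall>x \<in> {..<n}. h [x] = []"
        using morphism_letters [OF h(1) z(1)] z(2) by auto
      then show False
        using nonperiodic_nonempty_letter [OF h(2)] by blast
    qed
    ultimately show "answer_yes (NonPrim \<Gamma>) (word_of_system (n, E))"
      unfolding word NonPrim_def nonperiodic_morphism_def
      using h morphism_lists [OF h(1) ab(1)]
      by (auto intro!: exI [of _ "5::nat"] exI [of _ h] exI [of _ "h a"])
  next
    assume "answer_yes (NonPrim \<Gamma>) (word_of_system (n, E))"
    then obtain m h r where m: "m \<ge> 2" and h: "morphism {..<n} \<Gamma> h" "\<not> periodic {..<n} \<Gamma> h"
      and pow: "h (a @ a @ a @ a @ b) = word_power r m"
      unfolding word by (auto simp: NonPrim_def nonperiodic_morphism_def)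
    note len = length_morphism_letters_of_system [OF h(1) E, folded z_def]
    have no_shift: "s = []" if "s @ h g = h g @ t" "length s \<le> length (h z)" for s t
    proof (rule ccontr)
      assume "s \<noteq> []"
      have "h [x] @ s = s @ h [x]" if "x \<in> {..<n}" for x
        by (rule sync [of s "h z" "map (\<lambda>a. h [a]) z" t])
          (use \<open>s @ h g = h g @ t\<close> \<open>length s \<le> length (h z)\<close> hg [OF h(1)] z(2) that in auto)
      then show False
        using periodicI_comm [OF h(1) _ \<open>s \<noteq> []\<close>] h(2) by blast
    qed
    have "map h (map fst E) = map h (map snd E)"
    \<comment> \<open>The bound \<open>n\<close> of \<open>sides_eq\<close> becomes
      \<open>length (h z)\<close>: \<open>z\<close> contains all sides, and the marker begins with
      \<open>z\<close>.\<close>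
    proof (rule sides_eq [OF _ m])
      show "side (h g) (map h (map fst E)) @ side (h g) (map h (map fst E)) @
          side (h g) (map h (map fst E)) @ side (h g) (map h (map fst E)) @
          side (h g) (map h (map snd E)) = word_power r m"
        using pow hword [OF h(1)] ha [OF h(1)] hb [OF h(1)] by simp
      show "length (h z) \<le> length (h g)"
        using hg [OF h(1)] by simp
    qed (use len no_shift in auto)
    then have "\<forall>e \<in> set E. h (fst e) = h (snd e)"
      by simp
    then show "answer_yes (EqSatCF \<Gamma>) (n, E)"
      using h by (fastforce simp: EqSatCF_def nonperiodic_morphism_def solves_def)
  qed
qed

theorem theorem5p5:
  fixes \<Gamma> :: "'g set"
  assumes "finite \<Gamma>" and "card \<Gamma> \<ge> 2"
  shows "NonPrim \<Gamma> \<le>\<^sub>p EqSatCF \<Gamma> \<and> EqSatCF \<Gamma> \<le>\<^sub>p NonPrim \<Gamma>"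
proof
  obtain a b where ab: "a \<in> \<Gamma>" "b \<in> \<Gamma>" "a \<noteq> b"
    using assms(2) card_le_Suc0_iff_eq [OF assms(1)] by (metis not_less_eq_eq numeral_2_eq_2)
  have "system_of_word I \<in> instances (EqSatCF \<Gamma>) \<and>
      (answer_yes (NonPrim \<Gamma>) I \<longleftrightarrow> answer_yes (EqSatCF \<Gamma>) (system_of_word I))"
    if "I \<in> instances (NonPrim \<Gamma>)" for I
  proof -
    obtain n w where I: "I = (n, w)"
      by fastforce
    with that have w: "w \<in> lists {..<n}" "w \<noteq> []"
      by (auto simp: NonPrim_def)
    have "system_of_word I \<in> instances (EqSatCF \<Gamma>)"
      using w(1) by (auto simp: I EqSatCF_def system_of_word_def)
    then show ?thesis
      unfolding I using system_of_word_correct [OF ab w] by blast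
  qed
  then show "NonPrim \<Gamma> \<le>\<^sub>p EqSatCF \<Gamma>"
    unfolding poly_reducible_def using polytime_system_of_word by blast
  have "word_of_system I \<in> instances (NonPrim \<Gamma>) \<and>
      (answer_yes (EqSatCF \<Gamma>) I \<longleftrightarrow> answer_yes (NonPrim \<Gamma>) (word_of_system I))"
    if "I \<in> instances (EqSatCF \<Gamma>)" for I
  proof -
    obtain n E where I: "I = (n, E)"
      by fastforce
    with that have E: "n \<ge> 2" "set E \<subseteq> lists {..<n} \<times> lists {..<n}"
      by (auto simp: EqSatCF_def)
    show ?thesis
      unfolding I using word_of_system_instance(1) [OF E] word_of_system_correct [OF E] by blast
  qed
  then show "EqSatCF \<Gamma> \<le>\<^sub>p NonPrim \<Gamma>"
    unfolding poly_reducible_def using polytime_word_of_system by blast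
qed

end
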